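(* Let $G$ be a VPT graph and let $h\geq 3$. If $G$ is a minimal non $[h,2,1]$ graph with split partition $(S,K)$, then: (i) $|N(k)\cap S|=2$ for every $k\in K$; (ii) $|E(B(G/K))|=|K|$; (iii) $B(G/K)$ is $(h+1)$-critical.
   Context: All graphs are finite, simple and connected. A VPT representation of $G$ is a tree $T$ together with paths $(P_v)_{v\in V(G)}$ of $T$ such that $uv\in E(G)$ iff $P_u$ and $P_v$ share a vertex; $G$ is VPT if it has one. $[h,2,1]$ is the class of graphs admitting a VPT representation whose host tree has maximum degree at most $h$. A minimal non $[h,2,1]$ graph is a graph $G\notin[h,2,1]$ with $G-v\in[h,2,1]$ for all $v\in V(G)$. A graph is split if $V(G)$ can be partitioned into a stable set $S$ and a clique $K$ (split partition $(S,K)$). For a clique $C$ of $G$, the branch graph $B(G/C)$ has as vertices the vertices of $V(G)\setminus C$ adjacent to some vertex of $C$, and $v,w$ are adjacent in $B(G/C)$ iff $vw\notin E(G)$, some $x\in C$ is adjacent to both, some $y\in C$ is adjacent to $v$ but not $w$, and some $z\in C$ is adjacent to $w$ but not $v$. A graph $H$ with chromatic number $k$ is $k$-critical if $\chi(H-v)<k$ for every vertex $v$ and $\chi(H-e)<k$ for every edge $e$. *)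

theory Defs
  imports "Graph_Theory.Digraph_Component" "Graph_Theory.Vertex_Walk"
begin

text \<open>
  A finite simple graph is a \<^locale>\<open>pair_graph\<close>: an edge \<open>uv\<close> is present as the two
  arcs \<open>(u, v)\<close> and \<open>(v, u)\<close>. Connectedness is not part of \<^locale>\<open>pair_graph\<close>.
\<close>

definition nbhd :: "'a pair_pre_digraph \<Rightarrow> 'a \<Rightarrow> 'a set" where
  "nbhd G v = {w. (v, w) \<in> parcs G}"

definition uedges :: "'a pair_pre_digraph \<Rightarrow> 'a set set" where
  "uedges G = {{u, v} | u v. (u, v) \<in> parcs G}"

definition delete_vertex :: "'a pair_pre_digraph \<Rightarrow> 'a \<Rightarrow> 'a pair_pre_digraph" where
  "delete_vertex G v =
     \<lparr>pverts = pverts G - {v}, parcs = {(x, y) \<in> parcs G. x \<noteq> v \<and> y \<noteq> v}\<rparr>"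

definition delete_edge :: "'a pair_pre_digraph \<Rightarrow> 'a \<Rightarrow> 'a \<Rightarrow> 'a pair_pre_digraph" where
  "delete_edge G u v = \<lparr>pverts = pverts G, parcs = parcs G - {(u, v), (v, u)}\<rparr>"

definition stable :: "'a pair_pre_digraph \<Rightarrow> 'a set \<Rightarrow> bool" where
  "stable G S \<longleftrightarrow> S \<subseteq> pverts G \<and> (\<forall>u\<in>S. \<forall>v\<in>S. (u, v) \<notin> parcs G)"

definition clique :: "'a pair_pre_digraph \<Rightarrow> 'a set \<Rightarrow> bool" where
  "clique G K \<longleftrightarrow> K \<subseteq> pverts G \<and> (\<forall>u\<in>K. \<forall>v\<in>K. u \<noteq> v \<longrightarrow> (u, v) \<in> parcs G)"

definition split_partition :: "'a pair_pre_digraph \<Rightarrow> 'a set \<Rightarrow> 'a set \<Rightarrow> bool" where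
  "split_partition G S K \<longleftrightarrow>
     S \<union> K = pverts G \<and> S \<inter> K = {} \<and> stable G S \<and> clique G K"

text \<open>
  The library's \<^const>\<open>tree\<close> forbids all directed cycles, in particular the cycles of
  length two that arise from the two arcs of one edge, so only cycles of length at
  least three are excluded here.
\<close>

definition undirected_tree :: "'a pair_pre_digraph \<Rightarrow> bool" where
  "undirected_tree T \<longleftrightarrow>
     pair_graph T \<and> Digraph_Component.connected (with_proj T) \<and>
     \<not> (\<exists>p. pre_digraph.cycle (with_proj T) p \<and> 3 \<le> length p)"

definition VPT_representation ::
    "'a pair_pre_digraph \<Rightarrow> 'b pair_pre_digraph \<Rightarrow> ('a \<Rightarrow> 'b list) \<Rightarrow> bool" where
  "VPT_representation G T P \<longleftrightarrow>
     undirected_tree T \<and>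
     (\<forall>v\<in>pverts G. vpath (P v) (with_proj T)) \<and>
     (\<forall>u\<in>pverts G. \<forall>v\<in>pverts G. u \<noteq> v \<longrightarrow>
        ((u, v) \<in> parcs G \<longleftrightarrow> set (P u) \<inter> set (P v) \<noteq> {}))"

text \<open>
  Host trees are finite, so it is no restriction to take their vertices from
  \<^typ>\<open>nat\<close>.
\<close>

definition VPT :: "'a pair_pre_digraph \<Rightarrow> bool" where
  "VPT G \<longleftrightarrow>
     pair_graph G \<and> (\<exists>(T :: nat pair_pre_digraph) P. VPT_representation G T P)"

text \<open>The class \<open>[h,2,1]\<close>; in a symmetric digraph the out-degree is the degree.\<close>

definition h21 :: "nat \<Rightarrow> 'a pair_pre_digraph set" where
  "h21 h = {G. pair_graph G \<and>
     (\<exists>(T :: nat pair_pre_digraph) P. VPT_representation G T P \<and>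
        (\<forall>t\<in>pverts T. out_degree (with_proj T) t \<le> h))}"

text \<open>
  The graphs \<open>G - v\<close> need not be connected, which is why connectedness is not built
  into \<^const>\<open>h21\<close>.
\<close>

definition minimal_non_h21 :: "nat \<Rightarrow> 'a pair_pre_digraph \<Rightarrow> bool" where
  "minimal_non_h21 h G \<longleftrightarrow>
     pair_graph G \<and> G \<notin> h21 h \<and> (\<forall>v\<in>pverts G. delete_vertex G v \<in> h21 h)"

definition branch_graph :: "'a pair_pre_digraph \<Rightarrow> 'a set \<Rightarrow> 'a pair_pre_digraph" where
  "branch_graph G C =
     (let U = {v \<in> pverts G - C. \<exists>x\<in>C. (v, x) \<in> parcs G}
      in \<lparr>pverts = U,
          parcs = {(v, w). v \<in> U \<and> w \<in> U \<and> (v, w) \<notin> parcs G \<and>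
            (\<exists>x\<in>C. (x, v) \<in> parcs G \<and> (x, w) \<in> parcs G) \<and>
            (\<exists>y\<in>C. (y, v) \<in> parcs G \<and> (y, w) \<notin> parcs G) \<and>
            (\<exists>z\<in>C. (z, w) \<in> parcs G \<and> (z, v) \<notin> parcs G)}\<rparr>)"

definition proper_coloring :: "'a pair_pre_digraph \<Rightarrow> nat \<Rightarrow> ('a \<Rightarrow> nat) \<Rightarrow> bool" where
  "proper_coloring H n c \<longleftrightarrow>
     (\<forall>v\<in>pverts H. c v < n) \<and> (\<forall>(u, v)\<in>parcs H. c u \<noteq> c v)"

definition chromatic_number :: "'a pair_pre_digraph \<Rightarrow> nat" where
  "chromatic_number H = (LEAST n. \<exists>c. proper_coloring H n c)"

definition critical :: "nat \<Rightarrow> 'a pair_pre_digraph \<Rightarrow> bool" where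
  "critical k H \<longleftrightarrow>
     chromatic_number H = k \<and>
     (\<forall>v\<in>pverts H. chromatic_number (delete_vertex H v) < k) \<and>
     (\<forall>(u, v)\<in>parcs H. chromatic_number (delete_edge H u v) < k)"

lemma with_proj_delete_vertex:
  "with_proj (delete_vertex G v) = pre_digraph.del_vert (with_proj G) v"
  by (auto simp: delete_vertex_def with_proj_def pre_digraph.del_vert_def)

lemma pair_graph_iff:
  "pair_graph G \<longleftrightarrow> finite (pverts G) \<and> parcs G \<subseteq> pverts G \<times> pverts G \<and>
     sym (parcs G) \<and> irrefl (parcs G)"
proof
  assume "pair_graph G"
  then interpret pair_graph G .
  show "finite (pverts G) \<and> parcs G \<subseteq> pverts G \<times> pverts G \<and>
      sym (parcs G) \<and> irrefl (parcs G)"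
    using pair_finite_verts
    by (auto simp: sym_def irrefl_def
        dest: no_loops' in_arcsD1 in_arcsD2 intro: arcs_symmetric)
next
  assume a: "finite (pverts G) \<and> parcs G \<subseteq> pverts G \<times> pverts G \<and>
      sym (parcs G) \<and> irrefl (parcs G)"
  then have "finite (parcs G)"
    by (meson finite_SigmaI finite_subset)
  with a show "pair_graph G"
    by unfold_locales (auto simp: symmetric_def irrefl_def)
qed

lemma pair_graph_delete_vertex: "pair_graph G \<Longrightarrow> pair_graph (delete_vertex G v)"
  by (auto simp: pair_graph_iff delete_vertex_def sym_def irrefl_def)

lemma pair_graph_delete_edge: "pair_graph G \<Longrightarrow> pair_graph (delete_edge G u v)"
  by (auto simp: pair_graph_iff delete_edge_def sym_def irrefl_def)

lemma pair_graph_branch_graph: "pair_graph G \<Longrightarrow> pair_graph (branch_graph G C)"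
  by (auto simp: pair_graph_iff branch_graph_def Let_def sym_def irrefl_def)

lemma proper_coloring_chromatic_number:
  assumes "pair_graph H"
  shows "\<exists>c. proper_coloring H (chromatic_number H) c"
proof -
  obtain c where c: "bij_betw c (pverts H) {0..<card (pverts H)}"
    using assms ex_bij_betw_finite_nat unfolding pair_graph_iff by blast
  have "proper_coloring H (card (pverts H)) c"
    using assms c unfolding pair_graph_iff proper_coloring_def bij_betw_def
    by (fastforce simp: irrefl_def inj_on_def)
  then have "\<exists>n. \<exists>c. proper_coloring H n c"
    by blast
  then show ?thesis
    unfolding chromatic_number_def by (rule LeastI_ex)
qed

end

theory Submission
  imports Defs
begin

text \<open>
  In a representation of the split graph \<open>G\<close> the paths of \<open>K\<close> share a vertex \<open>q\<close> of the host tree.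
  The branches at \<open>q\<close> colour \<open>S\<close> in such a way that the neighbourhoods in \<open>K\<close> of vertices of equal
  colour are nested or disjoint and that every \<open>k \<in> K\<close> sees at most two colours. Conversely such a
  colouring with \<open>h \<ge> 3\<close> colours yields a host tree of maximum degree at most \<open>h\<close>. Starting from any
  representation, the colouring can be coarsened to \<open>h\<close> colours as soon as the branch graph is
  \<open>h\<close>-colourable on a set \<open>M\<close> of topmost vertices of the branches, whose neighbourhoods form an
  antichain and of which each \<open>k\<close> sees at most two. If \<open>G\<close> is minimal, then deleting any vertex of \<open>S\<close>
  makes the branch graph \<open>h\<close>-colourable, so \<open>M\<close> is the whole branch graph, all its degrees are at
  least \<open>h\<close>, and two of its vertices are adjacent iff they have a common neighbour in \<open>K\<close>. Because
  of these degrees, deleting \<open>k\<close> destroys at most the edge formed by the neighbours of \<open>k\<close>, and it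
  must destroy one since the colour number drops.
\<close>

section \<open>Walks in trees\<close>

abbreviation walk :: "'b rel \<Rightarrow> 'b list \<Rightarrow> bool" where
  "walk R p \<equiv> successively (\<lambda>x y. (x, y) \<in> R) p"

lemma walk_iff_vwalk_arcs: "walk R p \<longleftrightarrow> set (vwalk_arcs p) \<subseteq> R"
  by (induction p rule: vwalk_arcs.induct) auto

lemma pcas_vwalk_arcs: "p \<noteq> [] \<Longrightarrow> pcas (hd p) (vwalk_arcs p) (last p)"
  by (induction p rule: vwalk_arcs.induct) auto

lemma pawalk_verts_vwalk_arcs: "p \<noteq> [] \<Longrightarrow> pawalk_verts (hd p) (vwalk_arcs p) = p"
  by (induction p rule: vwalk_arcs.induct) auto

lemma rtrancl_imp_walk:
  assumes "(x, y) \<in> R\<^sup>*"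
  obtains p where "p \<noteq> []" "hd p = x" "last p = y" "distinct p" "walk R p"
proof -
  have "\<exists>p. p \<noteq> [] \<and> hd p = x \<and> last p = y \<and> distinct p \<and> walk R p"
    using assms
  proof (induction rule: converse_rtrancl_induct)
    case base
    show ?case by (rule exI[of _ "[y]"]) auto
  next
    case (step x z)
    then obtain p where p: "p \<noteq> []" "hd p = z" "last p = y" "distinct p" "walk R p"
      by blast
    show ?case
    proof (cases "x \<in> set p")
      case True
      then obtain a b where ab: "p = a @ x # b"
        by (meson split_list)
      show ?thesis
        by (rule exI[of _ "x # b"]) (use p ab in \<open>auto simp: successively_append_iff\<close>)
    next
      case False
      show ?thesis
        by (rule exI[of _ "x # p"]) (use p False step in \<open>auto simp: successively_Cons\<close>)
    qed
  qed
  with that show thesis by blast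
qed

lemma walk_imp_rtrancl:
  "walk R p \<Longrightarrow> x \<in> set p \<Longrightarrow> (hd p, x) \<in> R\<^sup>*"
proof (induction p rule: induct_list012)
  case (3 u v p)
  then show ?case
    by (auto intro: converse_rtrancl_into_rtrancl)
qed auto

lemma sym_rtranclD: "sym R \<Longrightarrow> (x, y) \<in> R\<^sup>* \<Longrightarrow> (y, x) \<in> R\<^sup>*"
  by (meson sym_rtrancl symD)

lemma walk_imp_rtrancl_sym:
  assumes "sym R" "walk R p" "x \<in> set p" "y \<in> set p"
  shows "(x, y) \<in> R\<^sup>*"
  using walk_imp_rtrancl[OF assms(2,3)] walk_imp_rtrancl[OF assms(2,4)] sym_rtranclD[OF assms(1)]
  by (meson rtrancl_trans)

lemma walk_subset_field:
  "walk R p \<Longrightarrow> hd p \<in> X \<Longrightarrow> R \<subseteq> UNIV \<times> X \<Longrightarrow> set p \<subseteq> X"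
  by (induction p rule: induct_list012) auto

section \<open>Connected vertex sets of a tree: separation, convexity and the Helly property\<close>

definition restr :: "'b rel \<Rightarrow> 'b set \<Rightarrow> 'b rel" where
  "restr A X = A \<inter> X \<times> X"

text \<open>For vertices other than \<open>q\<close>, its reflexive transitive closure means lying
  in the same branch at \<open>q\<close>.\<close>

abbreviation avoiding :: "'b rel \<Rightarrow> 'b \<Rightarrow> 'b rel" where
  "avoiding A q \<equiv> restr A (- {q})"

definition conn :: "'b rel \<Rightarrow> 'b set \<Rightarrow> bool" where
  "conn A X \<longleftrightarrow> (\<forall>x\<in>X. \<forall>y\<in>X. (x, y) \<in> (restr A X)\<^sup>*)"

lemma restr_mono: "X \<subseteq> Y \<Longrightarrow> restr A X \<subseteq> restr A Y"
  by (auto simp: restr_def)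

lemma walk_restr: "walk A p \<Longrightarrow> set p \<subseteq> X \<Longrightarrow> walk (restr A X) p"
  by (auto simp: restr_def elim!: successively_mono)

lemma sym_restr: "sym A \<Longrightarrow> sym (restr A X)"
  by (auto simp: restr_def sym_def)

lemma conn_avoiding:
  assumes "conn A X" "q \<notin> X" "x \<in> X" "y \<in> X"
  shows "(x, y) \<in> (avoiding A q)\<^sup>*"
proof -
  have "(restr A X)\<^sup>* \<subseteq> (avoiding A q)\<^sup>*"
    using assms(2) by (intro rtrancl_mono restr_mono) auto
  with assms show ?thesis by (auto simp: conn_def)
qed

lemma conn_walk:
  assumes "sym A" "walk A p"
  shows "conn A (set p)"
  unfolding conn_def
  using walk_imp_rtrancl_sym[OF sym_restr[OF assms(1)] walk_restr[OF assms(2) subset_refl]]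
  by blast

locale acyclic_edges =
  fixes A :: "'b rel"
  assumes sym_A: "sym A"
    and irrefl_A: "irrefl A"
    and no_cycle: "distinct p \<Longrightarrow> 3 \<le> length p \<Longrightarrow> walk A p \<Longrightarrow> (last p, hd p) \<notin> A"
begin

text \<open>A simple walk from \<open>b\<close> to \<open>b'\<close> that misses \<open>q\<close>
  would close up with \<open>q\<close> to a cycle of length at least three. So a branch at
  \<open>q\<close> contains only one neighbour of \<open>q\<close>.\<close>

lemma avoiding_rtrancl_imp_eq:
  assumes "(q, b) \<in> A" "(q, b') \<in> A" "(b, b') \<in> (avoiding A q)\<^sup>*"
  shows "b = b'"
proof (rule ccontr)
  assume ne: "b \<noteq> b'"
  from assms(3) obtain p where p: "p \<noteq> []" "hd p = b" "last p = b'" "distinct p"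
      "walk (avoiding A q) p"
    by (rule rtrancl_imp_walk)
  have "b \<noteq> q"
    using assms(1) irrefl_A by (auto simp: irrefl_def)
  then have q: "q \<notin> set p"
    using walk_subset_field[OF p(5), of "- {q}"] p(2) by (auto simp: restr_def)
  have "length p \<noteq> 1"
    using p ne by (auto simp: length_Suc_conv)
  with p(1) have "2 \<le> length p"
    by (cases p) (auto simp: Suc_le_eq)
  moreover have "walk A (q # p)"
    using p assms(1) by (auto simp: successively_Cons restr_def elim!: successively_mono)
  moreover have "(last (q # p), hd (q # p)) \<in> A"
    using p assms(2) sym_A by (auto simp: sym_def)
  ultimately show False
    using no_cycle[of "q # p"] p(4) q by auto
qed

text \<open>The two neighbours of \<open>a\<close> on the walk are distinct and hence lie in
  different branches at \<open>a\<close>; each part of the walk stays in the branch of its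
  neighbour.\<close>

lemma walk_separates:
  assumes "distinct (xs @ a # ys)" "walk A (xs @ a # ys)" "x \<in> set xs" "y \<in> set ys"
  shows "(x, y) \<notin> (avoiding A a)\<^sup>*"
proof
  assume xy: "(x, y) \<in> (avoiding A a)\<^sup>*"
  have s: "sym (avoiding A a)"
    by (rule sym_restr[OF sym_A])
  from assms(3,4) have ne: "xs \<noteq> []" "ys \<noteq> []"
    by auto
  have w: "walk A xs" "walk A ys" "(last xs, a) \<in> A" "(a, hd ys) \<in> A"
    using assms(2) ne by (auto simp: successively_append_iff successively_Cons)
  have "(last xs, x) \<in> (avoiding A a)\<^sup>*"
    by (rule walk_imp_rtrancl_sym[OF s walk_restr[OF w(1)]]) (use assms ne in auto)
  moreover have "(y, hd ys) \<in> (avoiding A a)\<^sup>*"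
    by (rule walk_imp_rtrancl_sym[OF s walk_restr[OF w(2)]]) (use assms ne in auto)
  ultimately have "(last xs, hd ys) \<in> (avoiding A a)\<^sup>*"
    using xy by (meson rtrancl_trans)
  moreover have "(a, last xs) \<in> A"
    using w(3) sym_A by (auto simp: sym_def)
  ultimately have "last xs = hd ys"
    using avoiding_rtrancl_imp_eq w(4) by blast
  moreover have "last xs \<in> set xs" "hd ys \<in> set ys"
    using ne by auto
  ultimately show False
    using assms(1) by auto
qed

text \<open>A vertex of the walk outside \<open>X\<close> would separate the two ends, although
  \<open>X\<close> joins them.\<close>

lemma conn_convex:
  assumes "conn A X" "p \<noteq> []" "distinct p" "walk A p" "hd p \<in> X" "last p \<in> X"
  shows "set p \<subseteq> X"
proof
  fix a assume "a \<in> set p"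
  then obtain xs ys where p: "p = xs @ a # ys"
    by (meson split_list)
  show "a \<in> X"
  proof (rule ccontr)
    assume a: "a \<notin> X"
    have ne: "xs \<noteq> []" "ys \<noteq> []"
      using a assms(5,6) p by auto
    then have "hd xs \<in> X" "last ys \<in> X"
      using assms(5,6) p by auto
    then have "(hd xs, last ys) \<in> (avoiding A a)\<^sup>*"
      using conn_avoiding[OF assms(1) a] by blast
    then show False
      using walk_separates[of xs a ys "hd xs" "last ys"] assms(3,4) p ne by auto
  qed
qed

lemma conn_walk_between:
  assumes "conn A X" "x \<in> X" "y \<in> X"
  obtains p where "p \<noteq> []" "hd p = x" "last p = y" "distinct p" "walk A p" "set p \<subseteq> X"
proof -
  have "(x, y) \<in> (restr A X)\<^sup>*"
    using assms by (auto simp: conn_def)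
  then obtain p where p: "p \<noteq> []" "hd p = x" "last p = y" "distinct p" "walk (restr A X) p"
    by (rule rtrancl_imp_walk)
  then have "walk A p"
    by (auto simp: restr_def elim!: successively_mono)
  moreover have "set p \<subseteq> X"
    using walk_subset_field[OF p(5), of X] p(2) assms by (auto simp: restr_def)
  ultimately show thesis
    using that p by blast
qed

lemma conn_Int:
  assumes "conn A X" "conn A Y"
  shows "conn A (X \<inter> Y)"
  unfolding conn_def
proof (intro ballI)
  fix x y assume xy: "x \<in> X \<inter> Y" "y \<in> X \<inter> Y"
  then obtain p where p: "p \<noteq> []" "hd p = x" "last p = y" "distinct p" "walk A p" "set p \<subseteq> X"
    using conn_walk_between[OF assms(1), of x y] by blast
  have "set p \<subseteq> Y"
    using conn_convex[OF assms(2)] p xy by auto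
  then have "walk (restr A (X \<inter> Y)) p"
    using p by (intro walk_restr) auto
  from walk_imp_rtrancl[OF this, of y] show "(x, y) \<in> (restr A (X \<inter> Y))\<^sup>*"
    using p by auto
qed

text \<open>On a walk in \<open>Z\<close> from \<open>Y\<close> to \<open>X\<close>, the last vertex
  \<open>m\<close> in \<open>Y\<close> must lie in \<open>X\<close>. Otherwise the rest of that
  walk, the set \<open>X\<close> and a walk in \<open>Y\<close> join two neighbours of
  \<open>m\<close> without using \<open>m\<close>. These would coincide, but only one of them is in
  \<open>Y\<close>.\<close>

lemma helly3:
  assumes "conn A X" "conn A Y" "conn A Z" "X \<inter> Y \<noteq> {}" "Y \<inter> Z \<noteq> {}" "X \<inter> Z \<noteq> {}"
  shows "X \<inter> Y \<inter> Z \<noteq> {}"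
proof -
  obtain a b c where abc: "a \<in> Y" "a \<in> Z" "b \<in> X" "b \<in> Z" "c \<in> X" "c \<in> Y"
    using assms by blast
  obtain p where p: "p \<noteq> []" "hd p = a" "last p = b" "distinct p" "walk A p" "set p \<subseteq> Z"
    using conn_walk_between[OF assms(3), of a b] abc by blast
  have "\<exists>x\<in>set p. x \<in> Y"
    using p(1,2) abc(1) by (metis hd_in_set)
  then obtain xs m ys where m: "p = xs @ m # ys" "m \<in> Y" "\<forall>x\<in>set ys. x \<notin> Y"
    using split_list_last_prop[of p "\<lambda>x. x \<in> Y"] by blast
  have "m \<in> X"
  proof (rule ccontr)
    assume mX: "m \<notin> X"
    then have ys: "ys \<noteq> []" "last ys = b"
      using p(3) m(1) abc(3) by auto
    obtain r where r: "r \<noteq> []" "hd r = m" "last r = c" "distinct r" "walk A r" "set r \<subseteq> Y"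
      using conn_walk_between[OF assms(2), of m c] abc m by blast
    obtain rs where rs: "r = m # rs" "rs \<noteq> []"
    proof (cases r)
      case (Cons u rs)
      have "m \<noteq> c" using mX abc by blast
      then have "rs \<noteq> []" using r(2,3) Cons by auto
      then show thesis using that Cons r(2) by simp
    qed (use r in simp)
    have "walk (avoiding A m) ys"
      using p m by (intro walk_restr) (auto simp: successively_append_iff successively_Cons)
    then have 1: "(hd ys, b) \<in> (avoiding A m)\<^sup>*"
      using walk_imp_rtrancl[of _ ys b] last_in_set[OF ys(1)] ys by auto
    have "walk (avoiding A m) rs"
      using r rs by (intro walk_restr) (auto simp: successively_Cons)
    then have "(hd rs, c) \<in> (avoiding A m)\<^sup>*"
      using walk_imp_rtrancl[of _ rs c] last_in_set[OF rs(2)] rs r(3) by auto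
    then have 2: "(c, hd rs) \<in> (avoiding A m)\<^sup>*"
      by (rule sym_rtranclD[OF sym_restr[OF sym_A]])
    have 3: "(b, c) \<in> (avoiding A m)\<^sup>*"
      using conn_avoiding[OF assms(1) mX] abc by blast
    have "(hd ys, hd rs) \<in> (avoiding A m)\<^sup>*"
      using 1 2 3 by (meson rtrancl_trans)
    moreover have "(m, hd ys) \<in> A" "(m, hd rs) \<in> A"
      using p(5) m(1) r(5) rs ys(1) by (simp_all add: successively_append_iff successively_Cons)
    ultimately have "hd ys = hd rs"
      using avoiding_rtrancl_imp_eq by blast
    moreover have "hd ys \<in> set ys" "hd rs \<in> Y"
      using r(6) rs(1) hd_in_set[OF rs(2)] hd_in_set[OF ys(1)] by auto
    ultimately show False
      using m(3) by auto
  qed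
  then show ?thesis
    using m p(6) by auto
qed

text \<open>Induction on \<open>I\<close>: intersecting all sets with the new one keeps them
  connected, and by \<open>helly3\<close> they still meet pairwise.\<close>

lemma helly:
  assumes "finite I" "I \<noteq> {}" "\<And>i. i \<in> I \<Longrightarrow> conn A (P i)"
    and "\<And>i j. i \<in> I \<Longrightarrow> j \<in> I \<Longrightarrow> P i \<inter> P j \<noteq> {}"
  shows "(\<Inter>i\<in>I. P i) \<noteq> {}"
  using assms
proof (induction I arbitrary: P rule: finite_ne_induct)
  case (singleton x)
  then show ?case by force
next
  case (insert x F)
  have "(\<Inter>i\<in>F. P i \<inter> P x) \<noteq> {}"
  proof (rule insert.IH)
    show "conn A (P i \<inter> P x)" if "i \<in> F" for i
      using that insert.prems(1) by (intro conn_Int) auto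
    show "P i \<inter> P x \<inter> (P j \<inter> P x) \<noteq> {}" if "i \<in> F" "j \<in> F" for i j
    proof -
      have "P i \<inter> P j \<inter> P x \<noteq> {}"
        using that insert.prems by (intro helly3) auto
      then show ?thesis by auto
    qed
  qed
  with insert.hyps show ?case by auto
qed

text \<open>Let \<open>a\<close> be the first vertex of the walk in either set, say in
  \<open>X\<close>. Then \<open>a\<close> separates \<open>q\<close> from \<open>Y\<close>, which is
  connected, avoids \<open>a\<close> and contains a later vertex of the walk. So a connected set
  that joins \<open>q\<close> to \<open>Y\<close> contains \<open>a\<close>. This turns the order
  along a clique path into an inclusion of neighbourhoods.\<close>

lemma first_hit_nested:
  assumes "distinct (q # ys)" "walk A (q # ys)" "conn A X" "conn A Y" "X \<inter> Y = {}"
    and "q \<notin> X" "set ys \<inter> X \<noteq> {}" "set ys \<inter> Y \<noteq> {}" "q \<notin> Y"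
  shows "(\<forall>Z. conn A Z \<longrightarrow> q \<in> Z \<longrightarrow> Z \<inter> Y \<noteq> {} \<longrightarrow> Z \<inter> X \<noteq> {}) \<or>
         (\<forall>Z. conn A Z \<longrightarrow> q \<in> Z \<longrightarrow> Z \<inter> X \<noteq> {} \<longrightarrow> Z \<inter> Y \<noteq> {})"
proof -
  have key: "Z \<inter> V \<noteq> {}"
    if ys: "ys = as @ a # bs" and "\<forall>x\<in>set as. x \<notin> V \<union> W" and "a \<in> V"
      and "set ys \<inter> W \<noteq> {}" and "conn A W" and "V \<inter> W = {}"
      and "conn A Z" "q \<in> Z" "Z \<inter> W \<noteq> {}" for V W Z as a bs
  proof (rule ccontr)
    assume ZV: "\<not> Z \<inter> V \<noteq> {}"
    obtain c where "c \<in> W" "c \<in> set ys"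
      using \<open>set ys \<inter> W \<noteq> {}\<close> by auto
    moreover have "c \<notin> set as" "c \<noteq> a"
      using \<open>c \<in> W\<close> \<open>\<forall>x\<in>set as. x \<notin> V \<union> W\<close> \<open>a \<in> V\<close> \<open>V \<inter> W = {}\<close> by blast+
    ultimately have c: "c \<in> W" "c \<in> set bs"
      using ys by auto
    obtain d where d: "d \<in> Z" "d \<in> W"
      using \<open>Z \<inter> W \<noteq> {}\<close> by auto
    have "(q, d) \<in> (avoiding A a)\<^sup>*"
      using conn_avoiding[OF \<open>conn A Z\<close>] \<open>a \<in> V\<close> \<open>q \<in> Z\<close> d ZV by blast
    moreover have "(d, c) \<in> (avoiding A a)\<^sup>*"
      using conn_avoiding[OF \<open>conn A W\<close>] \<open>a \<in> V\<close> \<open>V \<inter> W = {}\<close> d c by blast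
    ultimately have "(q, c) \<in> (avoiding A a)\<^sup>*"
      by (meson rtrancl_trans)
    then show False
      using walk_separates[of "q # as" a bs q c] assms(1,2) ys c by auto
  qed
  have "\<exists>x\<in>set ys. x \<in> X \<union> Y"
    using assms by auto
  then obtain as a bs where ys: "ys = as @ a # bs" "a \<in> X \<union> Y" "\<forall>x\<in>set as. x \<notin> X \<union> Y"
    using split_list_first_propE[of ys "\<lambda>x. x \<in> X \<union> Y"] by metis
  show ?thesis
  proof (cases "a \<in> X")
    case True
    have "Z \<inter> X \<noteq> {}" if "conn A Z" "q \<in> Z" "Z \<inter> Y \<noteq> {}" for Z
      by (rule key[OF ys(1,3) True assms(8,4,5) that])
    then show ?thesis by blast
  next
    case False
    then have aY: "a \<in> Y" and n: "\<forall>x\<in>set as. x \<notin> Y \<union> X"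
      using ys by auto
    have "Z \<inter> Y \<noteq> {}" if "conn A Z" "q \<in> Z" "Z \<inter> X \<noteq> {}" for Z
      by (rule key[OF ys(1) n aY assms(7,3) _ that]) (use assms(5) in blast)
    then show ?thesis by blast
  qed
qed

end

lemma undirected_tree_acyclic_edges:
  assumes "undirected_tree T"
  shows "acyclic_edges (parcs T)"
proof
  have pg: "pair_graph T" and nc: "\<not> (\<exists>p. pre_digraph.cycle (with_proj T) p \<and> 3 \<le> length p)"
    using assms by (auto simp: undirected_tree_def)
  then show "sym (parcs T)" "irrefl (parcs T)"
    by (auto simp: pair_graph_iff)
  fix p :: "'a list"
  assume p: "distinct p" "3 \<le> length p" "walk (parcs T) p"
  show "(last p, hd p) \<notin> parcs T"
  proof
    assume e: "(last p, hd p) \<in> parcs T"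
    let ?p = "p @ [hd p]"
    have ne: "p \<noteq> []" using p(2) by auto
    have "walk (parcs T) ?p"
      using p(3) e by (simp add: successively_append_iff)
    then have s: "set (vwalk_arcs ?p) \<subseteq> parcs T"
      by (simp add: walk_iff_vwalk_arcs)
    have c: "pcas (hd p) (vwalk_arcs ?p) (hd p)" "pawalk_verts (hd p) (vwalk_arcs ?p) = ?p"
      using pcas_vwalk_arcs[of ?p] pawalk_verts_vwalk_arcs[of ?p] ne by simp_all
    have "hd p \<in> pverts T"
      using e pg by (auto simp: pair_graph_iff)
    moreover have len: "length (vwalk_arcs ?p) = length p"
      using vwalk_length_simp[of ?p] unfolding vwalk_length_def by simp
    moreover have "distinct (tl ?p)"
      using p(1) ne by (cases p) auto
    ultimately have "pre_digraph.cycle (with_proj T) (vwalk_arcs ?p)"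
      unfolding pre_digraph.cycle_def pre_digraph.awalk_def cas_with_proj_eq
        awalk_verts_with_proj_eq
      using s c ne by (intro exI[of _ "hd p"]) auto
    with nc len p(2) show False by auto
  qed
qed

lemma undirected_tree_reachable:
  assumes "undirected_tree T" "x \<in> pverts T" "y \<in> pverts T"
  shows "(x, y) \<in> (parcs T)\<^sup>*"
proof -
  interpret pair_graph T
    using assms by (auto simp: undirected_tree_def)
  have "x \<rightarrow>\<^sup>*\<^bsub>mk_symmetric (with_proj T)\<^esub> y"
    using assms
    by (auto simp: undirected_tree_def Digraph_Component.connected_def strongly_connected_def
        mk_symmetric_def)
  then have "x \<rightarrow>\<^sup>*\<^bsub>with_proj T\<^esub> y"
    using reachable_mk_symmetric_eq sym_arcs by blast
  then show ?thesis
    using reachable_rtranclI by fastforce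
qed

section \<open>Branches of a host tree at a common vertex of the clique paths\<close>

text \<open>For the neighbourhoods in \<open>K\<close> of two vertices of \<open>S\<close>, the
  negation is adjacency in the branch graph.\<close>

definition nested_or_disjoint :: "'b set \<Rightarrow> 'b set \<Rightarrow> bool" where
  "nested_or_disjoint X Y \<longleftrightarrow> X \<inter> Y = {} \<or> X \<subseteq> Y \<or> Y \<subseteq> X"

text \<open>
  \<open>N s\<close> is the set of neighbours of \<open>s\<close> in \<open>K\<close>, and \<open>q\<close> is a vertex of the host tree that
  lies on all paths of \<open>K\<close>. The set \<open>F\<close> consists of the at most one vertex of \<open>S\<close> whose path
  contains \<open>q\<close>, and \<open>f\<close> maps the others to the branches at \<open>q\<close>.
\<close>
definition branch_coloring ::
    "'a set \<Rightarrow> 'b set \<Rightarrow> ('a \<Rightarrow> 'b set) \<Rightarrow> nat \<Rightarrow> 'a set \<Rightarrow> ('a \<Rightarrow> nat) \<Rightarrow> bool" where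
  "branch_coloring S K N m F f \<longleftrightarrow>
     F \<subseteq> S \<and> (\<forall>s\<in>F. \<forall>t\<in>F. s = t) \<and> (\<forall>s\<in>F. N s = K) \<and>
     (\<forall>s\<in>S - F. f s < m) \<and>
     (\<forall>s\<in>S - F. \<forall>t\<in>S - F. f s = f t \<longrightarrow> nested_or_disjoint (N s) (N t)) \<and>
     (\<forall>k\<in>K. card (f ` {s \<in> S - F. k \<in> N s}) \<le> 2)"

lemma vpath_with_proj_iff:
  "vpath p (with_proj T) \<longleftrightarrow> p \<noteq> [] \<and> distinct p \<and> set p \<subseteq> pverts T \<and> walk (parcs T) p"
  by (auto simp: vpath_def vwalk_def walk_iff_vwalk_arcs)

lemma out_degree_with_proj: "out_degree (with_proj T) t = card (nbhd T t)"
proof -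
  have "out_arcs (with_proj T) t = Pair t ` nbhd T t"
    by (auto simp: out_arcs_def nbhd_def)
  then show ?thesis
    by (simp add: out_degree_def card_image inj_on_def)
qed

locale split_representation =
  fixes G :: "'a pair_pre_digraph" and S K :: "'a set"
    and T :: "'b pair_pre_digraph" and P :: "'a \<Rightarrow> 'b list"
  assumes pair_graph: "pair_graph G"
    and rep: "VPT_representation G T P"
    and split: "split_partition G S K"
begin

sublocale acyclic_edges "parcs T"
  using rep by (auto simp: VPT_representation_def intro: undirected_tree_acyclic_edges)

lemma path:
  assumes "v \<in> S \<union> K"
  shows "P v \<noteq> []" "distinct (P v)" "walk (parcs T) (P v)" "set (P v) \<subseteq> pverts T"
    "conn (parcs T) (set (P v))"
proof -
  have "vpath (P v) (with_proj T)"
    using rep split assms by (auto simp: VPT_representation_def split_partition_def)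
  then show "P v \<noteq> []" "distinct (P v)" "walk (parcs T) (P v)" "set (P v) \<subseteq> pverts T"
    by (auto simp: vpath_with_proj_iff)
  then show "conn (parcs T) (set (P v))"
    using conn_walk sym_A by blast
qed

lemma adjacent_iff:
  assumes "u \<in> S \<union> K" "v \<in> S \<union> K" "u \<noteq> v"
  shows "(u, v) \<in> parcs G \<longleftrightarrow> set (P u) \<inter> set (P v) \<noteq> {}"
  using rep split assms by (auto simp: VPT_representation_def split_partition_def)

lemma clique_paths_meet:
  assumes "K \<noteq> {}"
  obtains q where "\<And>k. k \<in> K \<Longrightarrow> q \<in> set (P k)"
proof -
  have "finite K"
    using pair_graph split finite_subset[of K "pverts G"]
    by (auto simp: pair_graph_iff split_partition_def)
  moreover have "set (P i) \<inter> set (P j) \<noteq> {}" if "i \<in> K" "j \<in> K" for i j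
  proof (cases "i = j")
    case True
    then show ?thesis using path(1)[of i] that by auto
  next
    case False
    then show ?thesis
      using adjacent_iff[of i j] that split by (auto simp: split_partition_def clique_def)
  qed
  ultimately have "(\<Inter>k\<in>K. set (P k)) \<noteq> {}"
    using assms path(5) by (intro helly) auto
  with that show thesis by blast
qed

abbreviation clique_nbhd :: "'a \<Rightarrow> 'a set" where
  "clique_nbhd s \<equiv> nbhd G s \<inter> K"

lemma mem_clique_nbhd_iff:
  assumes "s \<in> S" "k \<in> K"
  shows "k \<in> clique_nbhd s \<longleftrightarrow> set (P k) \<inter> set (P s) \<noteq> {}"
proof -
  have "s \<noteq> k"
    using split assms by (auto simp: split_partition_def)
  then show ?thesis
    using adjacent_iff[of s k] assms by (auto simp: nbhd_def)
qed

lemma stable_paths_disjoint: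
  assumes "s \<in> S" "t \<in> S" "s \<noteq> t"
  shows "set (P s) \<inter> set (P t) = {}"
  using adjacent_iff[of s t] assms split by (auto simp: split_partition_def stable_def)

context
  fixes q
  assumes q: "\<And>k. k \<in> K \<Longrightarrow> q \<in> set (P k)" and qT: "q \<in> pverts T"
begin

text \<open>The second vertex of a walk from \<open>q\<close> to \<open>P s\<close> serves as
  \<open>b\<close>; the path of \<open>s\<close> stays in that branch because it misses
  \<open>q\<close>.\<close>

lemma branch_exists:
  assumes "s \<in> S" "q \<notin> set (P s)"
  obtains b where "(q, b) \<in> parcs T" "\<And>x. x \<in> set (P s) \<Longrightarrow> (b, x) \<in> (avoiding (parcs T) q)\<^sup>*"
proof -
  note p = path[of s]
  have hd: "hd (P s) \<in> set (P s)" "hd (P s) \<in> pverts T"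
    using p assms(1) by auto
  then have "(q, hd (P s)) \<in> (parcs T)\<^sup>*"
    using rep qT undirected_tree_reachable by (auto simp: VPT_representation_def)
  then obtain r where r: "r \<noteq> []" "hd r = q" "last r = hd (P s)" "distinct r" "walk (parcs T) r"
    by (rule rtrancl_imp_walk)
  have "q \<noteq> hd (P s)"
    using hd assms by auto
  then obtain ys where ys: "r = q # ys" "ys \<noteq> []"
    using r by (cases r) (auto split: if_splits)
  have "walk (avoiding (parcs T) q) ys"
    using r ys by (intro walk_restr) (auto simp: successively_Cons)
  then have "(hd ys, hd (P s)) \<in> (avoiding (parcs T) q)\<^sup>*"
    using walk_imp_rtrancl[of _ ys "last ys"] r(3) ys by auto
  moreover have "(hd (P s), x) \<in> (avoiding (parcs T) q)\<^sup>*" if "x \<in> set (P s)" for x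
    using conn_avoiding[OF p(5) assms(2) hd(1) that] assms(1) by auto
  moreover have "(q, hd ys) \<in> parcs T"
    using r(5) ys by (simp add: successively_Cons)
  ultimately show thesis
    using that by (meson rtrancl_trans)
qed

text \<open>A branch is represented by its neighbour of \<open>q\<close>, which is unique by
  \<open>avoiding_rtrancl_imp_eq\<close>.\<close>

definition branch :: "'a \<Rightarrow> 'b" where
  "branch s = (SOME b. (q, b) \<in> parcs T \<and> (\<forall>x\<in>set (P s). (b, x) \<in> (avoiding (parcs T) q)\<^sup>*))"

lemma branch:
  assumes "s \<in> S" "q \<notin> set (P s)"
  shows "(q, branch s) \<in> parcs T"
    and "x \<in> set (P s) \<Longrightarrow> (branch s, x) \<in> (avoiding (parcs T) q)\<^sup>*"
proof -
  have "\<exists>b. (q, b) \<in> parcs T \<and> (\<forall>x\<in>set (P s). (b, x) \<in> (avoiding (parcs T) q)\<^sup>*)"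
    using branch_exists[OF assms] by metis
  from someI_ex[OF this] show "(q, branch s) \<in> parcs T"
    and "x \<in> set (P s) \<Longrightarrow> (branch s, x) \<in> (avoiding (parcs T) q)\<^sup>*"
    by (auto simp: branch_def)
qed

lemma branch_eq_hd:
  assumes "s \<in> S" "q \<notin> set (P s)" "walk (parcs T) (q # ys)" "q \<notin> set ys"
    "x \<in> set ys" "x \<in> set (P s)"
  shows "branch s = hd ys"
proof -
  have ys: "ys \<noteq> []" using assms(5) by auto
  have "walk (avoiding (parcs T) q) ys"
    using assms by (intro walk_restr) (auto simp: successively_Cons)
  then have "(hd ys, x) \<in> (avoiding (parcs T) q)\<^sup>*"
    using walk_imp_rtrancl assms(5) by metis
  then have "(x, hd ys) \<in> (avoiding (parcs T) q)\<^sup>*"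
    by (rule sym_rtranclD[OF sym_restr[OF sym_A]])
  then have "(branch s, hd ys) \<in> (avoiding (parcs T) q)\<^sup>*"
    using branch(2)[OF assms(1,2,6)] by (meson rtrancl_trans)
  moreover have "(q, hd ys) \<in> parcs T"
    using assms(3) ys by (simp add: successively_Cons)
  ultimately show ?thesis
    using avoiding_rtrancl_imp_eq branch(1)[OF assms(1,2)] by blast
qed

lemma clique_path_split:
  assumes "k \<in> K"
  obtains xs ys where "set (P k) = insert q (set xs \<union> set ys)" "distinct (q # xs)" "distinct (q # ys)"
    "walk (parcs T) (q # xs)" "walk (parcs T) (q # ys)"
    "set xs \<inter> set ys = {}"
proof -
  obtain as bs where ab: "P k = as @ q # bs"
    using q[OF assms] by (meson split_list)
  note p = path(2,3)[of k]
  have "walk (parcs T) (rev (as @ [q]))"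
    using p assms ab sym_A unfolding successively_rev
    by (auto simp: successively_append_iff sym_def elim!: successively_mono)
  then show thesis
    using that[of "rev as" bs] p ab assms
    by (auto simp: successively_append_iff)
qed

text \<open>Each half of the path of \<open>k\<close>, read away from \<open>q\<close>, stays in the
  branch of its first vertex. If a half is empty, its \<open>hd\<close> is unspecified, but the
  bound two still holds.\<close>

lemma branch_count:
  assumes "k \<in> K"
  shows "card (branch ` {s \<in> S. q \<notin> set (P s) \<and> k \<in> clique_nbhd s}) \<le> 2"
proof -
  obtain xs ys where p: "set (P k) = insert q (set xs \<union> set ys)" "distinct (q # xs)"
    "distinct (q # ys)" "walk (parcs T) (q # xs)" "walk (parcs T) (q # ys)"
    by (rule clique_path_split[OF assms])
  have "branch s \<in> {hd xs, hd ys}" if s: "s \<in> S" "q \<notin> set (P s)" "k \<in> clique_nbhd s" for s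
  proof -
    obtain x where x: "x \<in> set (P k)" "x \<in> set (P s)"
      using mem_clique_nbhd_iff[OF s(1) assms] s(3) by auto
    then have "x \<in> set xs \<or> x \<in> set ys"
      using p(1) s(2) by auto
    then show ?thesis
      using branch_eq_hd[OF s(1,2) p(4)] branch_eq_hd[OF s(1,2) p(5)] p(2,3) x(2) by auto
  qed
  then have "branch ` {s \<in> S. q \<notin> set (P s) \<and> k \<in> clique_nbhd s} \<subseteq> {hd xs, hd ys}"
    by blast
  then have "card (branch ` {s \<in> S. q \<notin> set (P s) \<and> k \<in> clique_nbhd s}) \<le> card {hd xs, hd ys}"
    by (intro card_mono) auto
  also have "\<dots> \<le> 2"
    by (simp add: card_insert_if)
  finally show ?thesis .
qed

text \<open>If \<open>k\<close> is a common neighbour, both paths meet the path of \<open>k\<close>,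
  and they do so on the same half, since the two halves start in different branches. Then
  \<open>first_hit_nested\<close> applies to that half.\<close>

lemma branch_nested_or_disjoint:
  assumes s: "s \<in> S" "q \<notin> set (P s)" and t: "t \<in> S" "q \<notin> set (P t)"
    and eq: "branch s = branch t"
  shows "nested_or_disjoint (clique_nbhd s) (clique_nbhd t)"
proof (cases "s = t \<or> clique_nbhd s \<inter> clique_nbhd t = {}")
  case True
  then show ?thesis by (auto simp: nested_or_disjoint_def)
next
  case False
  then obtain k where k: "k \<in> K" "k \<in> clique_nbhd s" "k \<in> clique_nbhd t"
    by auto
  have disj: "set (P s) \<inter> set (P t) = {}"
    using stable_paths_disjoint s t False by auto
  obtain xs ys where p: "set (P k) = insert q (set xs \<union> set ys)" "distinct (q # xs)"
    "distinct (q # ys)" "walk (parcs T) (q # xs)" "walk (parcs T) (q # ys)" "set xs \<inter> set ys = {}"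
    by (rule clique_path_split[OF k(1)])
  have s_hit: "set xs \<inter> set (P s) \<noteq> {} \<or> set ys \<inter> set (P s) \<noteq> {}"
    using mem_clique_nbhd_iff[OF s(1) k(1)] k(2) p(1) s(2) by auto
  have t_hit: "set xs \<inter> set (P t) \<noteq> {} \<or> set ys \<inter> set (P t) \<noteq> {}"
    using mem_clique_nbhd_iff[OF t(1) k(1)] k(3) p(1) t(2) by auto
  have hd: "branch v = hd zs"
    if "zs = xs \<or> zs = ys" "v = s \<or> v = t" "set zs \<inter> set (P v) \<noteq> {}" for v zs
    using that branch_eq_hd[of v zs] s t p(2-5) by auto
  have hd_ne: "hd xs \<noteq> hd ys" if "xs \<noteq> []" "ys \<noteq> []"
    using that p(6) by (metis disjoint_iff hd_in_set)
  have both: "\<exists>zs. (zs = xs \<or> zs = ys) \<and> set zs \<inter> set (P s) \<noteq> {} \<and> set zs \<inter> set (P t) \<noteq> {}"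
  proof (rule ccontr)
    assume n: "\<not> ?thesis"
    then have "xs \<noteq> []" "ys \<noteq> []"
      using s_hit t_hit by force+
    moreover have "hd xs = hd ys"
      using n s_hit t_hit hd[of xs s] hd[of ys s] hd[of xs t] hd[of ys t] eq by metis
    ultimately show False
      using hd_ne by blast
  qed
  then obtain zs where zs: "distinct (q # zs)" "walk (parcs T) (q # zs)"
      "set zs \<inter> set (P s) \<noteq> {}" "set zs \<inter> set (P t) \<noteq> {}"
    using p(2-5) by blast
  have c: "conn (parcs T) (set (P s))" "conn (parcs T) (set (P t))"
    using path(5) s t by auto
  have sub: "clique_nbhd u \<subseteq> clique_nbhd v"
    if uv: "\<forall>Z. conn (parcs T) Z \<longrightarrow> q \<in> Z \<longrightarrow> Z \<inter> set (P u) \<noteq> {} \<longrightarrow> Z \<inter> set (P v) \<noteq> {}"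
      and "u \<in> S" "v \<in> S" for u v
  proof
    fix l assume l: "l \<in> clique_nbhd u"
    then have "set (P l) \<inter> set (P v) \<noteq> {}"
      using uv path(5)[of l] q[of l] mem_clique_nbhd_iff[of u l] that(2) by auto
    then show "l \<in> clique_nbhd v"
      using mem_clique_nbhd_iff[of v l] l that(3) by auto
  qed
  from first_hit_nested[OF zs(1,2) c disj s(2) zs(3,4) t(2)] show ?thesis
    using sub[of s t] sub[of t s] s(1) t(1) by (auto simp: nested_or_disjoint_def)
qed

end

lemma branch_coloring_of_representation:
  assumes deg: "\<forall>t\<in>pverts T. out_degree (with_proj T) t \<le> m" and "0 < m"
  shows "\<exists>F f. branch_coloring S K (\<lambda>s. nbhd G s \<inter> K) m F f"
proof (cases "K = {}")
  case True
  \<comment> \<open>Without clique vertices there is no \<open>q\<close>, but all neighbourhoods are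
    empty and the single colour 0 is below \<open>m\<close>.\<close>
  then have "branch_coloring S K (\<lambda>s. nbhd G s \<inter> K) m {} (\<lambda>_. 0)"
    using \<open>0 < m\<close> by (auto simp: branch_coloring_def nested_or_disjoint_def)
  then show ?thesis by blast
next
  case False
  obtain q where q: "\<And>k. k \<in> K \<Longrightarrow> q \<in> set (P k)"
    using clique_paths_meet[OF False] by blast
  have qT: "q \<in> pverts T"
    using False q path(4) by blast
  have pg: "pair_graph T"
    using rep by (auto simp: VPT_representation_def undirected_tree_def)
  then have "finite (nbhd T q)"
    by (auto simp: pair_graph_iff nbhd_def intro: finite_subset[of _ "pverts T"])
  moreover have "card (nbhd T q) \<le> card {..<m}"
    using deg qT by (auto simp: out_degree_with_proj)
  \<comment> \<open>\<open>g\<close> numbers the at most \<open>m\<close> neighbours of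
    \<open>q\<close>; these numbers serve as colours.\<close>
  ultimately obtain g where g: "g ` nbhd T q \<subseteq> {..<m}" "inj_on g (nbhd T q)"
    using card_le_inj[of "nbhd T q" "{..<m}"] by auto
  define F where "F = {s \<in> S. q \<in> set (P s)}"
  define br where "br = branch q"
  have br: "br s \<in> nbhd T q" if "s \<in> S - F" for s
    using branch(1)[OF q qT] that by (auto simp: F_def br_def nbhd_def)
  have "branch_coloring S K (\<lambda>s. nbhd G s \<inter> K) m F (\<lambda>s. g (br s))"
    unfolding branch_coloring_def
  proof (intro conjI ballI impI)
    show "F \<subseteq> S" by (auto simp: F_def)
    show "s = t" if "s \<in> F" "t \<in> F" for s t
      using that stable_paths_disjoint by (auto simp: F_def)
    show "clique_nbhd s = K" if "s \<in> F" for s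
      using that q mem_clique_nbhd_iff[of s] by (auto simp: F_def)
    show "g (br s) < m" if "s \<in> S - F" for s
      using br[OF that] g by auto
    show "nested_or_disjoint (clique_nbhd s) (clique_nbhd t)"
      if st: "s \<in> S - F" "t \<in> S - F" and "g (br s) = g (br t)" for s t
    proof -
      have "br s = br t"
        using that br g(2) by (auto dest: inj_onD)
      then show ?thesis
        using branch_nested_or_disjoint[OF q qT] st by (auto simp: F_def br_def)
    qed
    show "card ((\<lambda>s. g (br s)) ` {s \<in> S - F. k \<in> clique_nbhd s}) \<le> 2" if "k \<in> K" for k
    proof -
      have "{s \<in> S - F. k \<in> clique_nbhd s} = {s \<in> S. q \<notin> set (P s) \<and> k \<in> clique_nbhd s}"
        by (auto simp: F_def)
      then have c: "card (br ` {s \<in> S - F. k \<in> clique_nbhd s}) \<le> 2"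
        using branch_count[OF q qT that] by (simp add: br_def)
      have "finite (br ` {s \<in> S - F. k \<in> clique_nbhd s})"
        by (rule finite_subset[OF _ \<open>finite (nbhd T q)\<close>]) (use br in blast)
      from card_image_le[OF this, of g] c show ?thesis
        by (simp add: image_image)
    qed
  qed
  then show ?thesis by blast
qed

end

section \<open>The maximal neighbourhoods in the branches\<close>

text \<open>
  The set \<open>M0\<close> of the proof contains one vertex for each maximal neighbourhood in a colour
  class, and every \<open>k\<close> has at most two neighbours in \<open>M0\<close>. If the neighbourhood of \<open>t \<in> M0\<close> is
  contained in that of another \<open>u \<in> M0\<close>, then it meets the neighbourhood of no third element
  of \<open>M0\<close>, so \<open>t\<close> only has to avoid the colour of \<open>u\<close>. Hence only the remaining set \<open>M\<close>
  matters.
\<close>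
lemma branch_coloring_core:
  fixes f :: "'a \<Rightarrow> nat"
  assumes bc: "branch_coloring S K N m F f"
    and fin: "finite S" "finite K" and NK: "\<And>s. N s \<subseteq> K"
  obtains M where "M \<subseteq> S"
    and "\<And>s. s \<in> M \<Longrightarrow> N s \<noteq> {}"
    and "\<And>s t. s \<in> M \<Longrightarrow> t \<in> M \<Longrightarrow> s \<noteq> t \<Longrightarrow> \<not> N s \<subseteq> N t"
    and "\<And>k. k \<in> K \<Longrightarrow> card {s \<in> M. k \<in> N s} \<le> 2"
    and "\<And>h c. 2 \<le> h \<Longrightarrow> \<forall>s\<in>M. c s < h \<Longrightarrow>
           \<forall>s\<in>M. \<forall>t\<in>M. \<not> nested_or_disjoint (N s) (N t) \<longrightarrow> c s \<noteq> c t \<Longrightarrow>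
           \<exists>F f. branch_coloring S K N h F f"
proof -
  \<comment> \<open>For \<open>s\<close> in \<open>A\<close> the neighbourhoods of
    \<open>above s\<close> share the elements of \<open>N s\<close>, so they form a chain and their
    union \<open>X s\<close> is one of them.\<close>
  define A where "A = {s \<in> S - F. N s \<noteq> {}}"
  define above where "above s = {t \<in> S - F. f t = f s \<and> N s \<subseteq> N t}" for s
  define X where "X s = (\<Union>t\<in>above s. N t)" for s
  have nested: "N s \<subseteq> N t \<or> N t \<subseteq> N s"
    if "s \<in> S - F" "t \<in> S - F" "f s = f t" "N s \<inter> N t \<noteq> {}" for s t
  proof -
    have "nested_or_disjoint (N s) (N t)"
      using bc that(1-3) unfolding branch_coloring_def by blast
    then show ?thesis using that(4) by (auto simp: nested_or_disjoint_def)
  qed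
  have top_ex: "\<exists>t\<in>above s. N t = X s" if s: "s \<in> A" for s
  proof -
    have f: "finite (above s)" and s_above: "s \<in> above s"
      using fin(1) s by (auto simp: above_def A_def)
    then obtain t where t: "t \<in> above s" "\<And>u. u \<in> above s \<Longrightarrow> card (N u) \<le> card (N t)"
      using obtains_MAX[OF f, of "\<lambda>u. card (N u)"] Max_ge[of "(\<lambda>u. card (N u)) ` above s"]
      by (metis empty_iff finite_imageI imageI)
    have "N u \<subseteq> N t" if u: "u \<in> above s" for u
    proof -
      have "N u \<inter> N t \<noteq> {}"
        using u t(1) s by (auto simp: above_def A_def)
      then have "N u \<subseteq> N t \<or> N t \<subseteq> N u"
        using nested[of u t] u t(1) by (auto simp: above_def)
      then show ?thesis
        using t(2)[OF u] NK fin(2) by (metis card_seteq finite_subset order_refl)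
    qed
    then have "N t = X s"
      using t(1) by (auto simp: X_def)
    with t(1) show ?thesis by blast
  qed
  have X_eq: "X s = X t" if st: "s \<in> A" "t \<in> A" "f s = f t" "N s \<inter> N t \<noteq> {}" for s t
  proof -
    have sub: "X s \<subseteq> X t" if st: "s \<in> A" "t \<in> A" "f s = f t" "N s \<inter> N t \<noteq> {}" for s t
    proof -
      obtain a where a: "a \<in> above s" "N a = X s" using top_ex st by blast
      obtain b where b: "b \<in> above t" "N b = X t" using top_ex st by blast
      have "N a \<subseteq> N b \<or> N b \<subseteq> N a"
        using a b st by (intro nested) (auto simp: above_def)
      moreover have "a \<in> above t" if "N b \<subseteq> N a"
        using that a b st by (auto simp: above_def)
      ultimately show ?thesis
        using a b by (auto simp: X_def)
    qed
    show ?thesis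
      using sub[of s t] sub[of t s] st by auto
  qed
  \<comment> \<open>The choice depends only on \<open>f s\<close> and \<open>X s\<close>, so
    vertices that agree in both get the same representative.\<close>
  define top where "top s = (SOME t. t \<in> A \<and> f t = f s \<and> N t = X s)" for s
  have top: "top s \<in> A" "f (top s) = f s" "N s \<subseteq> N (top s)" if s: "s \<in> A" for s
  proof -
    obtain t where t: "t \<in> above s" "N t = X s"
      using top_ex s by blast
    then have "t \<in> A \<and> f t = f s \<and> N t = X s"
      using s by (auto simp: above_def A_def)
    from someI[of "\<lambda>t. t \<in> A \<and> f t = f s \<and> N t = X s", OF this]
    show "top s \<in> A" "f (top s) = f s" "N s \<subseteq> N (top s)"
      using t by (auto simp: top_def above_def)
  qed
  have top_eq: "top s = top t" if st: "s \<in> A" "t \<in> A" "f s = f t" "N s \<inter> N t \<noteq> {}" for s t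
    using X_eq[OF st] st(3) by (simp add: top_def)
  have top_top: "top t = t" if t: "t \<in> top ` A" for t
  proof -
    obtain s where s: "s \<in> A" "t = top s" using t by blast
    have "N s \<noteq> {}" "N s \<subseteq> N (top s)"
      using s(1) top(3)[OF s(1)] by (simp_all add: A_def)
    then have "N s \<inter> N (top s) \<noteq> {}" by blast
    from top_eq[OF s(1) top(1)[OF s(1)] top(2)[OF s(1), symmetric] this] show ?thesis
      using s(2) by simp
  qed
  define M0 where "M0 = top ` A"
  have M0_A: "t \<in> A" if "t \<in> M0" for t
    using that top by (auto simp: M0_def)
  have f_ne: "f s \<noteq> f t" if "s \<in> M0" "t \<in> M0" "s \<noteq> t" "N s \<inter> N t \<noteq> {}" for s t
    using top_eq[of s t] top_top[of s] top_top[of t] M0_A that by (auto simp: M0_def)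
  have finM0: "finite M0"
    using fin(1) by (auto simp: M0_def A_def)
  \<comment> \<open>Vertices of \<open>M0\<close> seen by the same \<open>k\<close> have different
    colours, so the bound on colours bounds their number.\<close>
  have card_M0: "card {s \<in> M0. k \<in> N s} \<le> 2" if "k \<in> K" for k
  proof -
    have "inj_on f {s \<in> M0. k \<in> N s}"
      using f_ne by (fastforce simp: inj_on_def)
    then have "card {s \<in> M0. k \<in> N s} = card (f ` {s \<in> M0. k \<in> N s})"
      by (simp add: card_image)
    also have "\<dots> \<le> card (f ` {s \<in> S - F. k \<in> N s})"
      using fin(1) M0_A by (intro card_mono) (auto simp: A_def)
    also have "\<dots> \<le> 2"
      using bc that by (auto simp: branch_coloring_def)
    finally show ?thesis .
  qed
  have two: "u = s \<or> u = t"
    if "s \<in> M0" "t \<in> M0" "u \<in> M0" "s \<noteq> t" "k \<in> N s" "k \<in> N t" "k \<in> N u" for s t u k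
  proof (rule ccontr)
    assume n: "\<not> ?thesis"
    have "card {s, t, u} \<le> card {s \<in> M0. k \<in> N s}"
      using that finM0 by (intro card_mono) auto
    moreover have "k \<in> K"
      using NK that(5) by blast
    ultimately show False
      using card_M0[of k] that(4) n by auto
  qed
  \<comment> \<open>Distinct elements of \<open>M0\<close> with equal neighbourhoods exclude each
    other, so both are missing from \<open>M\<close>.\<close>
  define M where "M = {t \<in> M0. \<forall>u\<in>M0. N t \<subseteq> N u \<longrightarrow> u = t}"
  show thesis
  proof (rule that[of M])
    show "M \<subseteq> S" "\<And>s. s \<in> M \<Longrightarrow> N s \<noteq> {}"
      "\<And>s t. s \<in> M \<Longrightarrow> t \<in> M \<Longrightarrow> s \<noteq> t \<Longrightarrow> \<not> N s \<subseteq> N t"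
      using M0_A by (auto simp: M_def A_def)
    show "card {s \<in> M. k \<in> N s} \<le> 2" if "k \<in> K" for k
    proof -
      have "card {s \<in> M. k \<in> N s} \<le> card {s \<in> M0. k \<in> N s}"
        using finM0 by (intro card_mono) (auto simp: M_def)
      then show ?thesis using card_M0[OF that] by simp
    qed
    fix h and c :: "'a \<Rightarrow> nat"
    assume h: "2 \<le> h" and c: "\<forall>s\<in>M. c s < h"
      and proper: "\<forall>s\<in>M. \<forall>t\<in>M. \<not> nested_or_disjoint (N s) (N t) \<longrightarrow> c s \<noteq> c t"
    define up where "up t = (SOME u. u \<in> M0 \<and> u \<noteq> t \<and> N t \<subseteq> N u)" for t
    have up: "up t \<in> M0" "up t \<noteq> t" "N t \<subseteq> N (up t)" if "t \<in> M0" "t \<notin> M" for t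
    proof -
      have "\<exists>u. u \<in> M0 \<and> u \<noteq> t \<and> N t \<subseteq> N u"
        using that by (auto simp: M_def)
      from someI_ex[OF this] show "up t \<in> M0" "up t \<noteq> t" "N t \<subseteq> N (up t)"
        by (auto simp: up_def)
    qed
    \<comment> \<open>A common element of \<open>N t\<close> and \<open>N t'\<close> also lies in
      \<open>N (up t)\<close>, and no \<open>k\<close> sees three elements of
      \<open>M0\<close>.\<close>
    have up_unique: "t' = up t"
      if "t \<in> M0" "t \<notin> M" "t' \<in> M0" "t \<noteq> t'" "N t \<inter> N t' \<noteq> {}" for t t'
      using two[of t "up t" t'] up[OF that(1,2)] that by auto
    \<comment> \<open>Outside \<open>M\<close>, only the colour of \<open>up t\<close> has to be
      avoided, and the colours 0 and 1 suffice. If \<open>up t\<close> is outside \<open>M\<close>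
      as well, then \<open>t\<close> and \<open>up t\<close> are each other's \<open>up\<close>, and
      comparing their distinct \<open>f\<close>-colours gives one of them 0 and the other 1.\<close>
    define d where "d t = (if t \<in> M then c t
      else if up t \<in> M then (if c (up t) = 0 then 1 else 0)
      else if f t < f (up t) then 0 else 1)" for t
    have d_less: "d t < h" for t
      using c h by (auto simp: d_def)
    have d_proper: "d s \<noteq> d t" if st: "s \<in> M0" "t \<in> M0" "s \<noteq> t" "N s \<inter> N t \<noteq> {}" for s t
    proof -
      have ts: "N t \<inter> N s \<noteq> {}" using st by auto
      consider "s \<in> M" "t \<in> M" | "s \<notin> M" "t \<in> M" | "s \<in> M" "t \<notin> M" | "s \<notin> M" "t \<notin> M"
        by blast
      then show ?thesis
      proof cases
        case 1
        then have "\<not> N s \<subseteq> N t" "\<not> N t \<subseteq> N s"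
          using st by (auto simp: M_def)
        then show ?thesis
          using 1 proper st by (auto simp: d_def nested_or_disjoint_def)
      next
        case 2
        then show ?thesis
          using up_unique[of s t] st by (auto simp: d_def)
      next
        case 3
        then show ?thesis
          using up_unique[of t s] st ts by (auto simp: d_def)
      next
        case 4
        then have "t = up s" "s = up t"
          using up_unique[of s t] up_unique[of t s] st ts by auto
        then show ?thesis
          using 4 f_ne[OF st] by (auto simp: d_def)
      qed
    qed
    \<comment> \<open>The default 0 is harmless: an empty neighbourhood is disjoint from every set
      and is seen by no \<open>k\<close>.\<close>
    define g where "g s = (if N s = {} then 0 else d (top s))" for s
    have "branch_coloring S K N h F g"
      unfolding branch_coloring_def
    proof (intro conjI ballI impI)
      show "F \<subseteq> S" "\<And>s t. s \<in> F \<Longrightarrow> t \<in> F \<Longrightarrow> s = t" "\<And>s. s \<in> F \<Longrightarrow> N s = K"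
        using bc by (auto simp: branch_coloring_def)
      show "g s < h" for s
        using d_less h by (auto simp: g_def)
      show "nested_or_disjoint (N s) (N t)"
        if st: "s \<in> S - F" "t \<in> S - F" "g s = g t" for s t
      proof (cases "N s \<inter> N t = {}")
        case True
        then show ?thesis by (simp add: nested_or_disjoint_def)
      next
        case False
        then have A: "s \<in> A" "t \<in> A" using st by (auto simp: A_def)
        have "N (top s) \<inter> N (top t) \<noteq> {}"
          using top(3)[OF A(1)] top(3)[OF A(2)] False by auto
        moreover have "d (top s) = d (top t)"
          using st False by (auto simp: g_def split: if_splits)
        ultimately have "top s = top t"
          using d_proper[of "top s" "top t"] A by (auto simp: M0_def)
        then have "f s = f t"
          using top(2) A by metis
        then show ?thesis
          using nested[OF st(1,2)] False by (auto simp: nested_or_disjoint_def)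
      qed
      show "card (g ` {s \<in> S - F. k \<in> N s}) \<le> 2" if k: "k \<in> K" for k
      proof -
        have "g s \<in> d ` {s \<in> M0. k \<in> N s}" if s: "s \<in> S - F" "k \<in> N s" for s
        proof -
          have "s \<in> A" using s by (auto simp: A_def)
          then have "top s \<in> {s \<in> M0. k \<in> N s}"
            using top[of s] s by (auto simp: M0_def)
          moreover have "g s = d (top s)" using s by (auto simp: g_def)
          ultimately show ?thesis by blast
        qed
        then have "card (g ` {s \<in> S - F. k \<in> N s}) \<le> card (d ` {s \<in> M0. k \<in> N s})"
          using finM0 by (intro card_mono) auto
        also have "\<dots> \<le> card {s \<in> M0. k \<in> N s}"
          using finM0 by (intro card_image_le) auto
        finally show ?thesis using card_M0[OF k] by simp
      qed
    qed
    then show "\<exists>F f. branch_coloring S K N h F f" by blast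
  qed
qed

section \<open>Host trees of words\<close>

lemma pcas_imp_walk:
  "pcas u p v \<Longrightarrow> set p \<subseteq> A \<Longrightarrow> walk A (u # map snd p) \<and> last (u # map snd p) = v"
proof (induction p arbitrary: u)
  case (Cons e p)
  then have "walk A (snd e # map snd p) \<and> last (snd e # map snd p) = v" "(u, snd e) \<in> A"
    by auto
  then show ?case by auto
qed auto

lemma pawalk_verts_eq_Cons: "pcas u p v \<Longrightarrow> pawalk_verts u p = u # map snd p"
  by (induction p arbitrary: u) auto

text \<open>Following \<open>par\<close> leads to the root since \<open>d\<close> decreases. On a
  cycle, both neighbours of a vertex of maximal \<open>d\<close> would have to be its
  parent.\<close>

lemma undirected_tree_of_parent:
  fixes par :: "'b \<Rightarrow> 'b" and d :: "'b \<Rightarrow> nat"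
  assumes fin: "finite V" and r: "r \<in> V"
    and par: "\<And>v. v \<in> V - {r} \<Longrightarrow> par v \<in> V" "\<And>v. v \<in> V - {r} \<Longrightarrow> d (par v) < d v"
  defines "A \<equiv> (\<lambda>v. (v, par v)) ` (V - {r}) \<union> (\<lambda>v. (par v, v)) ` (V - {r})"
  shows "undirected_tree \<lparr>pverts = V, parcs = A\<rparr>" (is "undirected_tree ?T")
  unfolding undirected_tree_def
proof (intro conjI)
  show pg: "pair_graph ?T"
    unfolding pair_graph_iff using fin par by (fastforce simp: A_def sym_def irrefl_def)
  then interpret pair_graph ?T .
  have to_root: "v \<rightarrow>\<^sup>*\<^bsub>with_proj ?T\<^esub> r" if "v \<in> V" for v
    using that
  proof (induction "d v" arbitrary: v rule: less_induct)
    case less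
    show ?case
    proof (cases "v = r")
      case True
      then show ?thesis using r by auto
    next
      case False
      then have "v \<rightarrow>\<^bsub>with_proj ?T\<^esub> par v" "par v \<rightarrow>\<^sup>*\<^bsub>with_proj ?T\<^esub> r"
        using less par by (auto simp: A_def)
      then show ?thesis
        unfolding reachable_def
        by (rule converse_rtrancl_on_into_rtrancl_on) (use less.prems in simp)
    qed
  qed
  show "Digraph_Component.connected (with_proj ?T)"
    unfolding Digraph_Component.connected_def
  proof (rule strongly_connectedI)
    show "verts (with_proj (mk_symmetric (with_proj ?T))) \<noteq> {}"
      using r by (auto simp: mk_symmetric_def)
    fix u v assume "u \<in> verts (with_proj (mk_symmetric (with_proj ?T)))"
      "v \<in> verts (with_proj (mk_symmetric (with_proj ?T)))"
    then have "u \<in> V" "v \<in> V" by (auto simp: mk_symmetric_def)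
    then have "u \<rightarrow>\<^sup>*\<^bsub>with_proj ?T\<^esub> v"
      using to_root symmetric_reachable[OF sym_arcs] by (meson reachable_trans)
    then show "u \<rightarrow>\<^sup>*\<^bsub>with_proj (mk_symmetric (with_proj ?T))\<^esub> v"
      by (rule reachable_mk_symmetricI)
  qed
  show "\<not> (\<exists>p. pre_digraph.cycle (with_proj ?T) p \<and> 3 \<le> length p)"
  proof
    assume "\<exists>p. pre_digraph.cycle (with_proj ?T) p \<and> 3 \<le> length p"
    then obtain p u where p: "set p \<subseteq> A" "pcas u p u" "distinct (tl (pawalk_verts u p))" "3 \<le> length p"
      by (auto simp: pre_digraph.cycle_def pre_digraph.awalk_def)
    define w where "w = u # map snd p"
    define n where "n = length p"
    have n: "3 \<le> n" "length w = Suc n" using p(4) by (auto simp: n_def w_def)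
    have "pawalk_verts u p = w"
      using pawalk_verts_eq_Cons[OF p(2)] by (simp add: w_def)
    then have dist: "distinct (tl w)" using p(3) by simp
    have wA: "walk A w" and "last w = u"
      using pcas_imp_walk[OF p(2,1)] by (auto simp: w_def)
    moreover have "w \<noteq> []"
      by (simp add: w_def)
    ultimately have "w ! n = u"
      using n last_conv_nth[of w] by simp
    then have w0: "w ! 0 = w ! n"
      by (simp add: w_def)
    have inj: "i = j" if "w ! i = w ! j" "1 \<le> i" "i \<le> n" "1 \<le> j" "j \<le> n" for i j
    proof -
      have "tl w ! (i - 1) = tl w ! (j - 1)"
        using that n by (simp add: nth_tl)
      then have "i - 1 = j - 1"
        using dist that n nth_eq_iff_index_eq[of "tl w" "i - 1" "j - 1"] by auto
      then show ?thesis using that by simp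
    qed
    have arc: "(w ! i, w ! Suc i) \<in> A" if "i < n" for i
      using wA n that by (simp add: successively_conv_nth)
    have parI: "y = par x" if "(x, y) \<in> A \<or> (y, x) \<in> A" "d y \<le> d x" for x y
      using that par(2) by (fastforce simp: A_def)
    obtain i where i: "1 \<le> i" "i \<le> n" "\<And>j. 1 \<le> j \<Longrightarrow> j \<le> n \<Longrightarrow> d (w ! j) \<le> d (w ! i)"
    proof -
      have f: "finite ((\<lambda>j. d (w ! j)) ` {1..n})" "(\<lambda>j. d (w ! j)) ` {1..n} \<noteq> {}"
        using n by auto
      then obtain i where "i \<in> {1..n}" "d (w ! i) = Max ((\<lambda>j. d (w ! j)) ` {1..n})"
        by (metis (no_types, lifting) Max_in imageE)
      then show thesis
        using that[of i] Max_ge[OF f(1)] by auto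
    qed
    \<comment> \<open>As \<open>w ! 0 = w ! n\<close>, the cycle has the indices 1 to
      \<open>n\<close>, and \<open>a\<close>, \<open>b\<close> are the cyclic neighbours of
      \<open>i\<close>. They differ because \<open>n\<close> is at least 3.\<close>
    define a where "a = (if i = 1 then n else i - 1)"
    define b where "b = (if i = n then 1 else i + 1)"
    have ab: "1 \<le> a" "a \<le> n" "1 \<le> b" "b \<le> n" "a \<noteq> b"
      using i n by (auto simp: a_def b_def)
    have "(w ! a, w ! i) \<in> A"
      using arc[of "i - 1"] i n w0 by (auto simp: a_def)
    then have 1: "w ! a = par (w ! i)"
      using parI i ab by blast
    have "(w ! i, w ! b) \<in> A"
      using arc[of i] arc[of 0] i n w0 by (auto simp: b_def)
    then have "w ! b = par (w ! i)"
      using parI i ab by blast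
    with 1 inj ab show False by metis
  qed
qed

text \<open>The first letter selects one of \<open>h\<close> branches at the root, the empty word;
  all later letters are bits. Thus only the root can have more than two children.\<close>

definition words :: "nat \<Rightarrow> nat \<Rightarrow> nat list set" where
  "words h n = {w. length w \<le> Suc n \<and> (w \<noteq> [] \<longrightarrow> hd w < h \<and> set (tl w) \<subseteq> {0, 1})}"

definition word_tree :: "nat \<Rightarrow> nat \<Rightarrow> nat pair_pre_digraph" where
  "word_tree h n = \<lparr>pverts = to_nat ` words h n,
     parcs = (\<lambda>w. (to_nat w, to_nat (butlast w))) ` (words h n - {[]}) \<union>
       (\<lambda>w. (to_nat (butlast w), to_nat w)) ` (words h n - {[]})\<rparr>"

lemma finite_words: "finite (words h n)"
proof (rule finite_subset)
  show "words h n \<subseteq> {w. set w \<subseteq> {..<h + 2} \<and> length w \<le> Suc n}"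
  proof
    fix w assume w: "w \<in> words h n"
    show "w \<in> {w. set w \<subseteq> {..<h + 2} \<and> length w \<le> Suc n}"
      using w by (cases w) (auto simp: words_def)
  qed
  show "finite {w. set w \<subseteq> {..<h + 2} \<and> length w \<le> Suc n}"
    by (rule finite_lists_length_le) simp
qed

lemma butlast_words: "w \<in> words h n \<Longrightarrow> butlast w \<in> words h n"
  by (cases w) (auto simp: words_def dest: in_set_butlastD)

lemma take_words: "w \<in> words h n \<Longrightarrow> take j w \<in> words h n"
  by (cases w; cases j) (auto simp: words_def dest: in_set_takeD)

lemma undirected_tree_word_tree: "undirected_tree (word_tree h n)"
proof -
  let ?par = "\<lambda>v. to_nat (butlast (from_nat v :: nat list))"
  let ?d = "\<lambda>v. length (from_nat v :: nat list)"
  let ?V = "to_nat ` words h n"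
  have "to_nat ` words h n - {to_nat ([] :: nat list)} = to_nat ` (words h n - {[]})"
    by auto
  then have "word_tree h n = \<lparr>pverts = ?V,
      parcs = (\<lambda>v. (v, ?par v)) ` (?V - {to_nat ([] :: nat list)}) \<union>
        (\<lambda>v. (?par v, v)) ` (?V - {to_nat ([] :: nat list)})\<rparr>"
    by (simp add: word_tree_def image_image)
  moreover have "undirected_tree \<dots>"
  proof (rule undirected_tree_of_parent[where d = ?d])
    show "finite ?V" by (simp add: finite_words)
    show "to_nat ([] :: nat list) \<in> ?V" by (auto simp: words_def)
    show "?par v \<in> ?V" if "v \<in> ?V - {to_nat ([] :: nat list)}" for v
      using that butlast_words by auto
    show "?d (?par v) < ?d v" if "v \<in> ?V - {to_nat ([] :: nat list)}" for v
      using that by auto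
  qed
  ultimately show ?thesis by simp
qed

text \<open>The root has at most \<open>h\<close> children. Any other word has one parent and at
  most two children, which needs \<open>3 \<le> h\<close>.\<close>

lemma out_degree_word_tree:
  assumes "3 \<le> h" "t \<in> pverts (word_tree h n)"
  shows "out_degree (with_proj (word_tree h n)) t \<le> h"
proof -
  obtain w where w: "t = to_nat w" "w \<in> words h n"
    using assms(2) by (auto simp: word_tree_def)
  show ?thesis
  proof (cases "w = []")
    case True
    have "nbhd (word_tree h n) t \<subseteq> (\<lambda>x. to_nat [x]) ` {..<h}"
    proof
      fix y assume "y \<in> nbhd (word_tree h n) t"
      then have "\<exists>v\<in>words h n - {[]}. butlast v = [] \<and> y = to_nat v"
        using w True by (auto simp: nbhd_def word_tree_def)
      then obtain v where v: "v \<in> words h n" "v \<noteq> []" "butlast v = []" "y = to_nat v"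
        by blast
      then have "v = [hd v]"
        by (cases v rule: rev_cases) auto
      then show "y \<in> (\<lambda>x. to_nat [x]) ` {..<h}"
        using v by (auto simp: words_def)
    qed
    then have "card (nbhd (word_tree h n) t) \<le> card ((\<lambda>x. to_nat [x]) ` {..<h})"
      by (intro card_mono) auto
    also have "\<dots> \<le> h"
      using card_image_le[of "{..<h}" "\<lambda>x. to_nat [x]"] by simp
    finally show ?thesis by (simp add: out_degree_with_proj)
  next
    case False
    have "nbhd (word_tree h n) t \<subseteq> {to_nat (butlast w), to_nat (w @ [0]), to_nat (w @ [1])}"
    proof
      fix y assume "y \<in> nbhd (word_tree h n) t"
      then have "y = to_nat (butlast w) \<or> (\<exists>v\<in>words h n - {[]}. butlast v = w \<and> y = to_nat v)"
        using w by (auto simp: nbhd_def word_tree_def)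
      then consider "y = to_nat (butlast w)"
        | v where "v \<in> words h n" "v \<noteq> []" "butlast v = w" "y = to_nat v"
        by blast
      then show "y \<in> {to_nat (butlast w), to_nat (w @ [0]), to_nat (w @ [1])}"
      proof cases
        case (2 v)
        then obtain x where v: "v = w @ [x]"
          by (metis append_butlast_last_id)
        then have "x \<in> {0, 1}"
          using 2(1) False by (auto simp: words_def)
        then show ?thesis using v 2 by auto
      qed auto
    qed
    then have "card (nbhd (word_tree h n) t) \<le> card {to_nat (butlast w), to_nat (w @ [0]), to_nat (w @ [1])}"
      by (intro card_mono) auto
    also have "\<dots> \<le> 3"
      by (simp add: card_insert_if)
    finally show ?thesis using assms(1) by (simp add: out_degree_with_proj)
  qed
qed

lemma successively_upt: "(\<And>k. i \<le> k \<Longrightarrow> Suc k < j \<Longrightarrow> R k (Suc k)) \<Longrightarrow> successively R [i..<j]"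
  by (simp add: successively_conv_nth)

section \<open>Paths through the root of the word tree\<close>

definition prefix_path :: "nat list \<Rightarrow> nat list" where
  "prefix_path w = map (\<lambda>j. to_nat (take j w)) [1..<Suc (length w)]"

lemma set_prefix_path: "set (prefix_path w) = {to_nat v | v. v \<noteq> [] \<and> (\<exists>u. w = v @ u)}"
proof (intro equalityI subsetI)
  fix x assume "x \<in> set (prefix_path w)"
  then obtain j where "1 \<le> j" "j \<le> length w" "x = to_nat (take j w)"
    by (auto simp: prefix_path_def)
  then show "x \<in> {to_nat v | v. v \<noteq> [] \<and> (\<exists>u. w = v @ u)}"
    by (auto intro!: exI[of _ "take j w"] exI[of _ "drop j w"])
next
  fix x assume "x \<in> {to_nat v | v. v \<noteq> [] \<and> (\<exists>u. w = v @ u)}"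
  then obtain v u where "w = v @ u" "v \<noteq> []" "x = to_nat v" by blast
  then show "x \<in> set (prefix_path w)"
    by (auto simp: prefix_path_def Suc_le_eq intro!: image_eqI[of _ _ "length v"])
qed

lemma distinct_prefix_path: "distinct (prefix_path w)"
proof -
  have "inj_on (\<lambda>j. to_nat (take j w)) {1..<Suc (length w)}"
  proof (rule inj_onI)
    fix i j assume ij: "i \<in> {1..<Suc (length w)}" "j \<in> {1..<Suc (length w)}"
      and "to_nat (take i w) = to_nat (take j w)"
    then have "length (take i w) = length (take j w)"
      by simp
    then show "i = j" using ij by simp
  qed
  then show ?thesis
    by (simp add: prefix_path_def distinct_map del: upt_Suc)
qed

lemma walk_prefix_path:
  assumes "w \<in> words h n"
  shows "walk (parcs (word_tree h n)) (to_nat ([] :: nat list) # prefix_path w)"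
proof -
  have "to_nat ([] :: nat list) # prefix_path w = map (\<lambda>j. to_nat (take j w)) [0..<Suc (length w)]"
    using upt_conv_Cons[of 0 "Suc (length w)"] by (simp add: prefix_path_def del: upt_Suc)
  moreover have "walk (parcs (word_tree h n)) (map (\<lambda>j. to_nat (take j w)) [0..<Suc (length w)])"
    unfolding successively_map
  proof (rule successively_upt)
    fix k assume "Suc k < Suc (length w)"
    then have "butlast (take (Suc k) w) = take k w" "take (Suc k) w \<noteq> []"
      by (auto simp: butlast_take)
    then show "(to_nat (take k w), to_nat (take (Suc k) w)) \<in> parcs (word_tree h n)"
      using take_words[OF assms, of "Suc k"]
      by (auto simp: word_tree_def intro!: image_eqI[of _ _ "take (Suc k) w"])
  qed
  ultimately show ?thesis by simp
qed

text \<open>A \<open>prefix_path\<close> omits the root, so two of them can be joined there;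
  different first letters make them disjoint.\<close>

lemma vpath_two_prefix_paths:
  assumes "u \<in> words h n" "w \<in> words h n" "u \<noteq> []" "w \<noteq> []" "hd u \<noteq> hd w"
  shows "vpath (rev (prefix_path u) @ to_nat ([] :: nat list) # prefix_path w) (with_proj (word_tree h n))"
  unfolding vpath_with_proj_iff
proof (intro conjI)
  have sym: "sym (parcs (word_tree h n))"
    using undirected_tree_word_tree[of h n] by (auto simp: undirected_tree_def pair_graph_iff)
  have "walk (parcs (word_tree h n)) (rev (to_nat ([] :: nat list) # prefix_path u))"
    unfolding successively_rev
    using walk_prefix_path[OF assms(1)] sym by (auto simp: sym_def elim!: successively_mono)
  then show "walk (parcs (word_tree h n)) (rev (prefix_path u) @ to_nat ([] :: nat list) # prefix_path w)"
    using walk_prefix_path[OF assms(2)]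
    by (simp add: successively_append_iff successively_Cons)
  have "set (prefix_path u) \<inter> set (prefix_path w) = {}"
    using assms(5) by (auto simp: set_prefix_path)
  then show "distinct (rev (prefix_path u) @ to_nat ([] :: nat list) # prefix_path w)"
    using distinct_prefix_path by (auto simp: set_prefix_path)
  have "set (prefix_path v) \<subseteq> to_nat ` words h n" if "v \<in> words h n" for v
    using take_words[OF that] by (auto simp: prefix_path_def)
  moreover have "[] \<in> words h n"
    by (auto simp: words_def)
  ultimately show "set (rev (prefix_path u) @ to_nat ([] :: nat list) # prefix_path w)
      \<subseteq> pverts (word_tree h n)"
    using assms(1,2) by (auto simp: word_tree_def)
qed auto

section \<open>A representation from a colouring\<close>

lemma card_le_2_imp_subset_pair:
  assumes "C \<subseteq> {..<h}" "card C \<le> 2" "2 \<le> (h :: nat)"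
  shows "\<exists>a b. a < h \<and> b < h \<and> a \<noteq> b \<and> C \<subseteq> {a, b}"
proof -
  have "\<exists>D. C \<subseteq> D \<and> D \<subseteq> {..<h} \<and> card D = 2"
    using assms by (intro exists_subset_between) auto
  then obtain D where D: "C \<subseteq> D" "D \<subseteq> {..<h}" "card D = 2" by blast
  then obtain a b where "D = {a, b}" "a \<noteq> b"
    by (meson card_2_iff)
  with D show ?thesis by auto
qed

text \<open>
  The bits of the words record membership in the sets \<open>N (es ! l)\<close>, where the list \<open>es\<close> is
  sorted by decreasing cardinality: if \<open>k \<in> N s\<close>, then the laminarity of the colour class
  of \<open>s\<close> makes the bits of \<open>s\<close> a prefix of those of \<open>k\<close>.
\<close>

lemma h21_of_branch_coloring:
  fixes G :: "'a pair_pre_digraph"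
  assumes pg: "pair_graph G" and split: "split_partition G S K" and h: "3 \<le> h"
    and bc: "branch_coloring S K (\<lambda>s. nbhd G s \<inter> K) h F f"
  shows "G \<in> h21 h"
proof -
  let ?N = "\<lambda>s. nbhd G s \<inter> K"
  have fin: "finite S" "finite K"
    using pg split finite_subset[of S "pverts G"] finite_subset[of K "pverts G"]
    by (auto simp: pair_graph_iff split_partition_def)
  obtain xs where xs: "set xs = S - F" "distinct xs"
    using finite_distinct_list[of "S - F"] fin by auto
  \<comment> \<open>Subtracting from \<open>card K\<close> reverses the order; nothing is truncated
    because all neighbourhoods lie in \<open>K\<close>.\<close>
  define es where "es = sort_key (\<lambda>s. card K - card (?N s)) xs"
  define n where "n = length es"
  have es: "set es = S - F" "distinct es"
    using xs by (auto simp: es_def)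
  have sorted: "card (?N (es ! j)) \<le> card (?N (es ! i))" if "i \<le> j" "j < n" for i j
  proof -
    have "sorted (map (\<lambda>s. card K - card (?N s)) es)"
      by (simp add: es_def)
    from sorted_nth_mono[OF this that(1)]
    have "card K - card (?N (es ! i)) \<le> card K - card (?N (es ! j))"
      using that by (simp add: n_def)
    moreover have "card (?N (es ! j)) \<le> card K" "card (?N (es ! i)) \<le> card K"
      by (auto intro!: card_mono fin)
    ultimately show ?thesis by linarith
  qed
  have "\<exists>i<n. es ! i = s" if "s \<in> S - F" for s
    using that es by (auto simp: n_def in_set_conv_nth)
  then obtain ix where ix: "\<And>s. s \<in> S - F \<Longrightarrow> ix s < n \<and> es ! ix s = s"
    by metis
  define two_colors where "two_colors k a b \<longleftrightarrow> a < h \<and> b < h \<and> a \<noteq> b \<and>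
    f ` {s \<in> S - F. k \<in> ?N s} \<subseteq> {a, b}" for k a b
  \<comment> \<open>Exactly two colours are fixed, even if \<open>k\<close> sees fewer, so that the
    halves of its path start with different letters.\<close>
  have "\<exists>a b. two_colors k a b" if "k \<in> K" for k
    using bc that h unfolding branch_coloring_def two_colors_def
    by (intro card_le_2_imp_subset_pair) auto
  then obtain a b where "\<And>k. k \<in> K \<Longrightarrow> two_colors k (a k) (b k)"
    by metis
  then have ab: "a k < h \<and> b k < h \<and> a k \<noteq> b k \<and> f ` {s \<in> S - F. k \<in> ?N s} \<subseteq> {a k, b k}"
    if "k \<in> K" for k
    using that by (simp add: two_colors_def)
  \<comment> \<open>The word of \<open>s\<close> ends with the bit of \<open>s\<close> itself, so
    its length determines \<open>s\<close> and its last bit is 1.\<close>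
  define sw :: "'a \<Rightarrow> nat list" where "sw s = f s #
    map (\<lambda>l. of_bool (f (es ! l) = f s \<and> ?N s \<subseteq> ?N (es ! l))) [0..<Suc (ix s)]" for s
  \<comment> \<open>The path of a clique vertex passes through all prefixes of two such words. Since
    a vertex of \<open>S - F\<close> occupies the single tree vertex \<open>sw s\<close>, meeting
    that path means that \<open>sw s\<close> is a prefix of one of the two words.\<close>
  define kw :: "nat \<Rightarrow> 'a \<Rightarrow> nat list" where "kw c k = c #
    map (\<lambda>l. of_bool (f (es ! l) = c \<and> k \<in> ?N (es ! l))) [0..<n]" for c k
  define P where "P v = (if v \<in> K
      then rev (prefix_path (kw (a v) v)) @ to_nat ([] :: nat list) # prefix_path (kw (b v) v)
      else if v \<in> F then [to_nat ([] :: nat list)] else [to_nat (sw v)])" for v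
  have f_less: "f s < h" if "s \<in> S - F" for s
    using bc that by (auto simp: branch_coloring_def)
  have sw_words: "sw s \<in> words h n" if "s \<in> S - F" for s
    using f_less[OF that] ix[OF that] by (auto simp: sw_def words_def)
  have kw_words: "kw c k \<in> words h n" if "c < h" for c k
    using that by (auto simp: kw_def words_def)
  have KF: "v \<notin> K" if "v \<in> S" for v
    using split that by (auto simp: split_partition_def)
  have FS: "F \<subseteq> S" using bc by (auto simp: branch_coloring_def)
  have prefix_iff: "(\<exists>u. kw c k = sw s @ u) \<longleftrightarrow> c = f s \<and> k \<in> ?N s"
    if s: "s \<in> S - F" for c k s
  proof
    assume "\<exists>u. kw c k = sw s @ u"
    then obtain u where u: "kw c k = sw s @ u" by blast
    then have c: "c = f s"
      by (simp add: kw_def sw_def)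
    have eq: "map (\<lambda>l. of_bool (f (es ! l) = f s \<and> k \<in> ?N (es ! l)) :: nat) [0..<n] =
        map (\<lambda>l. of_bool (f (es ! l) = f s \<and> ?N s \<subseteq> ?N (es ! l))) [0..<Suc (ix s)] @ u"
      using u unfolding c by (simp add: kw_def sw_def del: upt_Suc)
    \<comment> \<open>Bit \<open>ix s\<close> is 1 in the word of \<open>s\<close>, and in the word
      of \<open>k\<close> it tests membership in the neighbourhood of \<open>s\<close>.\<close>
    have "(of_bool (k \<in> ?N s) :: nat) = 1"
      using arg_cong[OF eq, of "\<lambda>w. w ! ix s"] ix[OF s] by (auto simp: nth_append)
    then have "k \<in> ?N s"
      by (simp only: of_bool_eq_1_iff)
    with c show "c = f s \<and> k \<in> ?N s" by blast
  next
    assume ck: "c = f s \<and> k \<in> ?N s"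
    \<comment> \<open>An earlier set of the same colour class that contains \<open>k\<close> meets
      the neighbourhood of \<open>s\<close> and is at least as large, so laminarity makes it a
      superset.\<close>
    have bit: "?N s \<subseteq> ?N (es ! l) \<longleftrightarrow> k \<in> ?N (es ! l)" if l: "l < Suc (ix s)" "f (es ! l) = f s" for l
    proof
      assume k: "k \<in> ?N (es ! l)"
      have "l < n" using l ix[OF s] by auto
      then have "es ! l \<in> S - F"
        using nth_mem[of l es] es(1) by (simp only: n_def)
      then have "nested_or_disjoint (?N s) (?N (es ! l))"
        using bc s l(2) unfolding branch_coloring_def by metis
      moreover have "card (?N s) \<le> card (?N (es ! l))"
        using sorted[of l "ix s"] l ix[OF s] by auto
      ultimately show "?N s \<subseteq> ?N (es ! l)"
        using k ck fin card_seteq[of "?N s" "?N (es ! l)"]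
        by (auto simp: nested_or_disjoint_def)
    qed (use ck in auto)
    have "(f (es ! l) = f s \<and> ?N s \<subseteq> ?N (es ! l)) = (f (es ! l) = c \<and> k \<in> ?N (es ! l))"
      if "l \<in> set [0..<Suc (ix s)]" for l
      using that ck bit[of l] by (cases "f (es ! l) = f s") auto
    then have "map (\<lambda>l. of_bool (f (es ! l) = f s \<and> ?N s \<subseteq> ?N (es ! l)) :: nat) [0..<Suc (ix s)]
      = map (\<lambda>l. of_bool (f (es ! l) = c \<and> k \<in> ?N (es ! l))) [0..<Suc (ix s)]"
      by (intro map_cong refl arg_cong[where f = of_bool])
    moreover have "[0..<n] = [0..<Suc (ix s)] @ [Suc (ix s)..<n]"
      using ix[OF s] upt_add_eq_append[of 0 "Suc (ix s)" "n - Suc (ix s)"] by auto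
    ultimately show "\<exists>u. kw c k = sw s @ u"
      using ck by (simp add: kw_def sw_def del: upt_Suc)
  qed
  have setK: "set (P k) = insert (to_nat ([] :: nat list))
      {to_nat v | v. v \<noteq> [] \<and> ((\<exists>u. kw (a k) k = v @ u) \<or> (\<exists>u. kw (b k) k = v @ u))}"
    if "k \<in> K" for k
    using that by (auto simp: P_def set_prefix_path)
  have SK: "set (P s) \<inter> set (P k) \<noteq> {} \<longleftrightarrow> k \<in> ?N s" if s: "s \<in> S" and k: "k \<in> K" for s k
  proof (cases "s \<in> F")
    case True
    then show ?thesis
      using bc k KF[OF s] setK[OF k] by (auto simp: P_def branch_coloring_def)
  next
    case False
    then have sF: "s \<in> S - F" using s by simp
    have "sw s \<noteq> []" by (simp add: sw_def)
    then have "set (P s) \<inter> set (P k) \<noteq> {} \<longleftrightarrow>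
        (\<exists>u. kw (a k) k = sw s @ u) \<or> (\<exists>u. kw (b k) k = sw s @ u)"
      using False KF[OF s] setK[OF k] by (auto simp: P_def)
    also have "\<dots> \<longleftrightarrow> (a k = f s \<or> b k = f s) \<and> k \<in> ?N s"
      unfolding prefix_iff[OF sF] by blast
    also have "\<dots> \<longleftrightarrow> k \<in> ?N s"
      using ab[OF k] sF k by auto
    finally show ?thesis .
  qed
  have SS: "set (P s) \<inter> set (P t) = {}" if st: "s \<in> S" "t \<in> S" "s \<noteq> t" for s t
  proof -
    have ne: "sw s \<noteq> sw t" if "s \<notin> F" "t \<notin> F"
    proof
      assume "sw s = sw t"
      then have "length (sw s) = length (sw t)" by simp
      then have "ix s = ix t" by (simp add: sw_def)
      then show False using ix[of s] ix[of t] st that by auto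
    qed
    have "\<not> (s \<in> F \<and> t \<in> F)"
      using bc st by (auto simp: branch_coloring_def)
    moreover have "sw s \<noteq> []" "sw t \<noteq> []" by (simp_all add: sw_def)
    ultimately show ?thesis
      using ne KF st by (auto simp: P_def)
  qed
  have "VPT_representation G (word_tree h n) P"
    unfolding VPT_representation_def
  proof (intro conjI ballI impI)
    show "undirected_tree (word_tree h n)" by (rule undirected_tree_word_tree)
    show "vpath (P v) (with_proj (word_tree h n))" if v: "v \<in> pverts G" for v
    proof (cases "v \<in> K")
      case True
      have "kw c v \<noteq> []" "hd (kw c v) = c" for c
        by (simp_all add: kw_def)
      then show ?thesis
        using True ab[OF True] kw_words[of "a v" v] kw_words[of "b v" v]
          vpath_two_prefix_paths[of "kw (a v) v" h n "kw (b v) v"]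
        by (simp add: P_def)
    next
      case False
      have "[] \<in> words h n" by (simp add: words_def)
      then show ?thesis
        using False v split sw_words[of v]
        by (auto simp: P_def vpath_with_proj_iff word_tree_def split_partition_def)
    qed
    fix u v assume uv: "u \<in> pverts G" "v \<in> pverts G" "u \<noteq> v"
    have sym: "(u, v) \<in> parcs G \<longleftrightarrow> (v, u) \<in> parcs G"
      using pg by (auto simp: pair_graph_iff sym_def)
    consider "u \<in> S" "v \<in> S" | "u \<in> S" "v \<in> K" | "u \<in> K" "v \<in> S" | "u \<in> K" "v \<in> K"
      using uv split by (auto simp: split_partition_def)
    then show "(u, v) \<in> parcs G \<longleftrightarrow> set (P u) \<inter> set (P v) \<noteq> {}"
    proof cases
      case 1
      then have "(u, v) \<notin> parcs G"
        using split by (auto simp: split_partition_def stable_def)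
      then show ?thesis using SS[OF 1 uv(3)] by simp
    next
      case 2
      then show ?thesis using SK[OF 2] by (auto simp: nbhd_def)
    next
      case 3
      then show ?thesis using SK[OF 3(2,1)] sym by (auto simp: nbhd_def Int_commute)
    next
      case 4
      then have "(u, v) \<in> parcs G"
        using split uv(3) by (auto simp: split_partition_def clique_def)
      then show ?thesis using setK 4 by auto
    qed
  qed
  then show ?thesis
    using pg out_degree_word_tree[OF h] unfolding h21_def by blast
qed

section \<open>Deleting vertices of a minimal non \<open>[h,2,1]\<close> graph\<close>

lemma chromatic_number_le: "proper_coloring H n c \<Longrightarrow> chromatic_number H \<le> n"
  unfolding chromatic_number_def by (intro Least_le) blast

lemma proper_coloring_mono: "proper_coloring H n c \<Longrightarrow> n \<le> n' \<Longrightarrow> proper_coloring H n' c"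
  by (fastforce simp: proper_coloring_def)

lemma split_partition_delete_vertex:
  "split_partition G S K \<Longrightarrow> split_partition (delete_vertex G v) (S - {v}) (K - {v})"
  by (auto simp: split_partition_def delete_vertex_def stable_def clique_def)

locale minimal_non_h21_split =
  fixes G :: "'a pair_pre_digraph" and S K :: "'a set" and h :: nat
  assumes vpt: "VPT G" and h: "3 \<le> h" and minimal: "minimal_non_h21 h G"
    and split: "split_partition G S K"
begin

abbreviation N :: "'a \<Rightarrow> 'a set" where
  "N s \<equiv> nbhd G s \<inter> K"

definition U :: "'a set" where
  "U = {s \<in> S. N s \<noteq> {}}"

lemma pair_graph: "pair_graph G"
  using minimal by (simp add: minimal_non_h21_def)

lemma finite_S_K: "finite S" "finite K"
  using pair_graph split finite_subset[of S "pverts G"] finite_subset[of K "pverts G"]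
  by (auto simp: pair_graph_iff split_partition_def)

lemma finite_U: "finite U"
  using finite_S_K by (simp add: U_def)

lemma S_K_disjoint: "s \<in> S \<Longrightarrow> s \<notin> K"
  using split by (auto simp: split_partition_def)

lemma arc_commute: "(u, v) \<in> parcs G \<longleftrightarrow> (v, u) \<in> parcs G"
  using pair_graph by (auto simp: pair_graph_iff sym_def)

lemma pverts_branch_graph: "pverts (branch_graph G K) = U"
  using split by (auto simp: branch_graph_def U_def nbhd_def split_partition_def)

lemma parcs_branch_graph:
  "(s, t) \<in> parcs (branch_graph G K) \<longleftrightarrow> s \<in> U \<and> t \<in> U \<and> \<not> nested_or_disjoint (N s) (N t)"
proof -
  have V: "{v \<in> pverts G - K. \<exists>x\<in>K. (v, x) \<in> parcs G} = U"
    using pverts_branch_graph by (simp add: branch_graph_def Let_def)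
  have "(s, t) \<notin> parcs G" if "s \<in> U" "t \<in> U"
    using that split by (auto simp: U_def split_partition_def stable_def)
  moreover have "(x, s) \<in> parcs G \<longleftrightarrow> x \<in> N s" if "x \<in> K" for x s
    using that arc_commute by (auto simp: nbhd_def)
  ultimately show ?thesis
    unfolding branch_graph_def Let_def V by (auto simp: nested_or_disjoint_def)
qed

text \<open>By minimality the graph without \<open>v\<close> has a representation of degree at most
  \<open>h\<close>, whose branches give the colouring.\<close>

lemma coloring_delete_vertex:
  assumes v: "v \<in> pverts G"
  obtains c :: "'a \<Rightarrow> nat" where "\<And>s. c s < h"
    and "\<And>s t. s \<in> S - {v} \<Longrightarrow> t \<in> S - {v} \<Longrightarrow>
           \<not> nested_or_disjoint (N s - {v}) (N t - {v}) \<Longrightarrow> c s \<noteq> c t"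
proof -
  let ?G = "delete_vertex G v"
  have "?G \<in> h21 h"
    using minimal v by (simp add: minimal_non_h21_def)
  then obtain T :: "nat pair_pre_digraph" and P where
    T: "VPT_representation ?G T P" "\<forall>t\<in>pverts T. out_degree (with_proj T) t \<le> h"
    by (auto simp: h21_def)
  interpret split_representation ?G "S - {v}" "K - {v}" T P
    using T pair_graph_delete_vertex[OF pair_graph] split_partition_delete_vertex[OF split]
    by (intro split_representation.intro)
  obtain F f where bc: "branch_coloring (S - {v}) (K - {v}) (\<lambda>s. nbhd ?G s \<inter> (K - {v})) h F f"
    using branch_coloring_of_representation[OF T(2)] h by auto
  have nb: "nbhd ?G s \<inter> (K - {v}) = N s - {v}" if "s \<noteq> v" for s
    using that by (auto simp: nbhd_def delete_vertex_def)
  \<comment> \<open>Vertices of \<open>F\<close> see all of \<open>K - {v}\<close>, so their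
    neighbourhoods are comparable with every other one and the default colour 0 causes no
    conflict.\<close>
  define c where "c s = (if s \<in> S - {v} - F then f s else 0)" for s
  show thesis
  proof (rule that[of c])
    show "c s < h" for s
      using bc h by (auto simp: c_def branch_coloring_def)
    fix s t assume st: "s \<in> S - {v}" "t \<in> S - {v}" "\<not> nested_or_disjoint (N s - {v}) (N t - {v})"
    have "N u - {v} = K - {v}" if "u \<in> F" for u
      using that bc nb[of u] by (auto simp: branch_coloring_def)
    then have "s \<notin> F" "t \<notin> F"
      using st(3) by (auto simp: nested_or_disjoint_def)
    moreover have "nested_or_disjoint (N s - {v}) (N t - {v})"
      if "s \<notin> F" "t \<notin> F" "f s = f t"
    proof -
      have "nested_or_disjoint (nbhd ?G s \<inter> (K - {v})) (nbhd ?G t \<inter> (K - {v}))"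
        using bc that st(1,2) unfolding branch_coloring_def by blast
      then show ?thesis using nb[of s] nb[of t] st by simp
    qed
    ultimately show "c s \<noteq> c t"
      using st by (auto simp: c_def)
  qed
qed

lemma coloring_delete_stable_vertex:
  assumes "v \<in> S"
  obtains c :: "'a \<Rightarrow> nat" where "\<And>s. c s < h"
    and "\<And>s t. s \<in> S - {v} \<Longrightarrow> t \<in> S - {v} \<Longrightarrow> \<not> nested_or_disjoint (N s) (N t) \<Longrightarrow> c s \<noteq> c t"
proof -
  have "v \<in> pverts G" using assms split by (auto simp: split_partition_def)
  moreover have "N s - {v} = N s" for s
    using S_K_disjoint[OF assms] by blast
  ultimately show thesis
    using coloring_delete_vertex[of v] that by auto
qed

text \<open>All three claims hold for the set \<open>M\<close> of
  \<open>branch_coloring_core\<close>: a proper colouring of \<open>M\<close> with \<open>h\<close>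
  colours would put \<open>G\<close> into \<open>h21 h\<close>. A vertex of \<open>U\<close> outside
  \<open>M\<close> cannot exist, as its deletion would leave \<open>M\<close> intact and yield such
  a colouring.\<close>

lemma U_properties:
  shows not_colorable: "\<And>c. \<forall>s\<in>U. c s < h \<Longrightarrow>
      \<exists>s\<in>U. \<exists>t\<in>U. \<not> nested_or_disjoint (N s) (N t) \<and> c s = c t"
    and antichain: "\<And>s t. s \<in> U \<Longrightarrow> t \<in> U \<Longrightarrow> s \<noteq> t \<Longrightarrow> \<not> N s \<subseteq> N t"
    and card_fibre_le: "\<And>k. k \<in> K \<Longrightarrow> card {s \<in> U. k \<in> N s} \<le> 2"
proof -
  obtain T :: "nat pair_pre_digraph" and P where T: "VPT_representation G T P"
    using vpt by (auto simp: VPT_def)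
  interpret split_representation G S K T P
    using T pair_graph split by (intro split_representation.intro)
  have "pair_graph T"
    using T by (auto simp: VPT_representation_def undirected_tree_def)
  \<comment> \<open>Any degree bound serves here; \<open>Suc\<close> makes it positive.\<close>
  then have "card (nbhd T t) \<le> Suc (card (pverts T))" for t
    by (intro le_SucI card_mono) (auto simp: pair_graph_iff nbhd_def)
  then have "\<forall>t\<in>pverts T. out_degree (with_proj T) t \<le> Suc (card (pverts T))"
    by (simp add: out_degree_with_proj)
  from branch_coloring_of_representation[OF this]
  obtain F f where bc: "branch_coloring S K N (Suc (card (pverts T))) F f"
    by auto
  obtain M where M: "M \<subseteq> S" "\<And>s. s \<in> M \<Longrightarrow> N s \<noteq> {}"
      "\<And>s t. s \<in> M \<Longrightarrow> t \<in> M \<Longrightarrow> s \<noteq> t \<Longrightarrow> \<not> N s \<subseteq> N t"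
      "\<And>k. k \<in> K \<Longrightarrow> card {s \<in> M. k \<in> N s} \<le> 2"
    and col: "\<And>h c. 2 \<le> h \<Longrightarrow> \<forall>s\<in>M. c s < h \<Longrightarrow>
           \<forall>s\<in>M. \<forall>t\<in>M. \<not> nested_or_disjoint (N s) (N t) \<longrightarrow> c s \<noteq> c t \<Longrightarrow>
           \<exists>F f. branch_coloring S K N h F f"
    by (rule branch_coloring_core[OF bc finite_S_K]) auto
  have nc: "\<exists>s\<in>M. \<exists>t\<in>M. \<not> nested_or_disjoint (N s) (N t) \<and> c s = c t"
    if c: "\<forall>s\<in>M. c s < h" for c
  proof (rule ccontr)
    assume "\<not> ?thesis"
    then have "\<exists>F f. branch_coloring S K N h F f"
      using col[of h c] c h by auto
    then have "G \<in> h21 h"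
      using h21_of_branch_coloring[OF pair_graph split h] by blast
    then show False
      using minimal by (simp add: minimal_non_h21_def)
  qed
  have "U \<subseteq> M"
  proof
    fix v assume v: "v \<in> U"
    then have "v \<in> S" by (simp add: U_def)
    then obtain c :: "'a \<Rightarrow> nat" where c: "\<And>s. c s < h"
      "\<And>s t. s \<in> S - {v} \<Longrightarrow> t \<in> S - {v} \<Longrightarrow> \<not> nested_or_disjoint (N s) (N t) \<Longrightarrow> c s \<noteq> c t"
      by (rule coloring_delete_stable_vertex) blast
    show "v \<in> M"
    proof (rule ccontr)
      assume "v \<notin> M"
      then have "M \<subseteq> S - {v}" using M(1) by blast
      then show False using nc[of c] c by blast
    qed
  qed
  then have "U = M"
    using M(1,2) by (auto simp: U_def)
  then show "\<And>c. \<forall>s\<in>U. c s < h \<Longrightarrow>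
      \<exists>s\<in>U. \<exists>t\<in>U. \<not> nested_or_disjoint (N s) (N t) \<and> c s = c t"
    and "\<And>s t. s \<in> U \<Longrightarrow> t \<in> U \<Longrightarrow> s \<noteq> t \<Longrightarrow> \<not> N s \<subseteq> N t"
    and "\<And>k. k \<in> K \<Longrightarrow> card {s \<in> U. k \<in> N s} \<le> 2"
    using nc M(3,4) by auto
qed

lemma not_nested_or_disjoint_iff:
  "s \<in> U \<Longrightarrow> t \<in> U \<Longrightarrow> \<not> nested_or_disjoint (N s) (N t) \<longleftrightarrow> s \<noteq> t \<and> N s \<inter> N t \<noteq> {}"
  using antichain[of s t] antichain[of t s] by (auto simp: nested_or_disjoint_def)

lemma fibre_two:
  assumes "s \<in> U" "t \<in> U" "u \<in> U" "s \<noteq> t" "k \<in> N s" "k \<in> N t" "k \<in> N u"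
  shows "u = s \<or> u = t"
proof (rule ccontr)
  assume n: "\<not> ?thesis"
  have "card {s, t, u} \<le> card {s \<in> U. k \<in> N s}"
    using assms finite_U by (intro card_mono) auto
  moreover have "k \<in> K" using assms by blast
  ultimately show False
    using card_fibre_le[of k] assms(4) n by auto
qed

text \<open>With fewer than \<open>h\<close> neighbours, \<open>s\<close> could take a colour free
  among them, extending the colouring obtained by deleting \<open>s\<close> to all of
  \<open>U\<close>.\<close>

lemma degree_ge:
  assumes s: "s \<in> U"
  shows "h \<le> card {t \<in> U. t \<noteq> s \<and> N s \<inter> N t \<noteq> {}}" (is "_ \<le> card ?D")
proof (rule ccontr)
  assume less: "\<not> h \<le> card ?D"
  have "s \<in> S" using s by (simp add: U_def)
  then obtain c :: "'a \<Rightarrow> nat" where c: "\<And>s. c s < h"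
    "\<And>u t. u \<in> S - {s} \<Longrightarrow> t \<in> S - {s} \<Longrightarrow> \<not> nested_or_disjoint (N u) (N t) \<Longrightarrow> c u \<noteq> c t"
    by (rule coloring_delete_stable_vertex) blast
  have "card (c ` ?D) < card {..<h}"
    using less finite_U card_image_le[of ?D c] by simp
  then have "\<not> {..<h} \<subseteq> c ` ?D"
    using finite_U card_mono[of "c ` ?D" "{..<h}"] by fastforce
  then obtain x where x: "x < h" "x \<notin> c ` ?D"
    by auto
  have "\<exists>u\<in>U. \<exists>t\<in>U. \<not> nested_or_disjoint (N u) (N t) \<and> (c(s := x)) u = (c(s := x)) t"
    using c x by (intro not_colorable) auto
  then obtain u t where ut: "u \<in> U" "t \<in> U" "\<not> nested_or_disjoint (N u) (N t)"
      "(c(s := x)) u = (c(s := x)) t"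
    by blast
  have ne: "u \<noteq> t" "N u \<inter> N t \<noteq> {}"
    using ut not_nested_or_disjoint_iff by auto
  consider "u = s" | "t = s" | "u \<noteq> s" "t \<noteq> s" by blast
  then show False
  proof cases
    case 1
    then have "t \<in> ?D" using ut ne by auto
    then show False using x 1 ut(4) ne by auto
  next
    case 2
    then have "u \<in> ?D" using ut ne by auto
    then show False using x 2 ut(4) ne by auto
  next
    case 3
    then show False
      using c(2)[of u t] ut by (auto simp: U_def)
  qed
qed

text \<open>
  By \<open>degree_ge\<close>, \<open>s\<close> has two branch graph neighbours besides \<open>t\<close>, and the witnesses for
  them are distinct and lie outside \<open>N t\<close>.
\<close>
lemma private_neighbour:
  assumes st: "s \<in> U" "t \<in> U" "s \<noteq> t"
  shows "N s - N t - {k} \<noteq> {}"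
proof -
  let ?D = "{t \<in> U. t \<noteq> s \<and> N s \<inter> N t \<noteq> {}}"
  have "2 \<le> card (?D - {t})"
    using degree_ge[OF st(1)] h diff_card_le_card_Diff[of "{t}" ?D] by simp
  then obtain X where X: "X \<subseteq> ?D - {t}" "card X = 2"
    by (meson obtain_subset_with_card_n)
  then obtain u v where "X = {u, v}" "u \<noteq> v"
    by (meson card_2_iff)
  with X have uv: "u \<in> ?D - {t}" "v \<in> ?D - {t}" "u \<noteq> v"
    by blast+
  obtain x where x: "x \<in> N s" "x \<in> N u" using uv(1) by auto
  obtain y where y: "y \<in> N s" "y \<in> N v" using uv(2) by auto
  have "x \<notin> N t" using fibre_two[of s t u x] x st uv by auto
  moreover have "y \<notin> N t" using fibre_two[of s t v y] y st uv by auto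
  moreover have "x \<noteq> y" using fibre_two[of s u v x] x y st uv by auto
  ultimately show ?thesis using x y by blast
qed

text \<open>By \<open>private_neighbour\<close>, deleting \<open>k\<close> makes no two of the
  neighbourhoods nested. So only an edge whose ends have no common neighbour besides
  \<open>k\<close> can vanish.\<close>

lemma coloring_delete_clique_vertex:
  assumes k: "k \<in> K"
  obtains c :: "'a \<Rightarrow> nat" where "\<And>s. c s < h"
    and "\<And>s t. s \<in> U \<Longrightarrow> t \<in> U \<Longrightarrow> s \<noteq> t \<Longrightarrow> N s \<inter> N t - {k} \<noteq> {} \<Longrightarrow> c s \<noteq> c t"
proof -
  have "k \<in> pverts G" using k split by (auto simp: split_partition_def)
  then obtain c :: "'a \<Rightarrow> nat" where c: "\<And>s. c s < h"
    "\<And>s t. s \<in> S - {k} \<Longrightarrow> t \<in> S - {k} \<Longrightarrow>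
       \<not> nested_or_disjoint (N s - {k}) (N t - {k}) \<Longrightarrow> c s \<noteq> c t"
    by (rule coloring_delete_vertex) blast
  show thesis
  proof (rule that[of c])
    fix s t assume st: "s \<in> U" "t \<in> U" "s \<noteq> t" "N s \<inter> N t - {k} \<noteq> {}"
    then have "s \<in> S - {k}" "t \<in> S - {k}"
      using k S_K_disjoint by (auto simp: U_def)
    moreover have "\<not> nested_or_disjoint (N s - {k}) (N t - {k})"
      using private_neighbour[of s t k] private_neighbour[of t s k] st
      by (auto simp: nested_or_disjoint_def)
    ultimately show "c s \<noteq> c t" by (rule c(2))
  qed (rule c(1))
qed

text \<open>The colouring obtained by deleting \<open>k\<close> uses \<open>h\<close> colours, so it
  fails on some edge of the branch graph; such an edge owes its presence to \<open>k\<close>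
  alone.\<close>

lemma ex_edge_at_clique_vertex:
  assumes k: "k \<in> K"
  obtains s t where "s \<in> U" "t \<in> U" "s \<noteq> t" "N s \<inter> N t = {k}"
proof -
  obtain c :: "'a \<Rightarrow> nat" where c: "\<And>s. c s < h"
    "\<And>s t. s \<in> U \<Longrightarrow> t \<in> U \<Longrightarrow> s \<noteq> t \<Longrightarrow> N s \<inter> N t - {k} \<noteq> {} \<Longrightarrow> c s \<noteq> c t"
    using coloring_delete_clique_vertex[OF k] by blast
  obtain s t where st: "s \<in> U" "t \<in> U" "\<not> nested_or_disjoint (N s) (N t)" "c s = c t"
    using not_colorable[of c] c(1) by blast
  then have "s \<noteq> t" "N s \<inter> N t \<noteq> {}"
    using not_nested_or_disjoint_iff by auto
  moreover have "N s \<inter> N t - {k} = {}"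
    using c(2)[OF st(1,2)] st(4) \<open>s \<noteq> t\<close> by metis
  ultimately have "N s \<inter> N t = {k}"
    by blast
  then show thesis
    using that st \<open>s \<noteq> t\<close> by blast
qed

section \<open>Clique vertices as edges of the branch graph\<close>

lemma fibre_eq:
  assumes "s \<in> U" "t \<in> U" "s \<noteq> t" "k \<in> N s" "k \<in> N t"
  shows "{u \<in> U. k \<in> N u} = {s, t}"
proof (intro equalityI subsetI)
  fix u assume "u \<in> {u \<in> U. k \<in> N u}"
  then show "u \<in> {s, t}"
    using fibre_two[OF assms(1,2) _ assms(3-5), of u] by blast
qed (use assms in blast)

lemma mem_edge_iff:
  "(s, t) \<in> parcs (branch_graph G K) \<longleftrightarrow> s \<in> U \<and> t \<in> U \<and> s \<noteq> t \<and> N s \<inter> N t \<noteq> {}"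
  using parcs_branch_graph not_nested_or_disjoint_iff by blast

lemma card_fibre:
  assumes "k \<in> K"
  shows "card {s \<in> U. k \<in> N s} = 2"
proof -
  obtain s t where st: "s \<in> U" "t \<in> U" "s \<noteq> t" "N s \<inter> N t = {k}"
    by (rule ex_edge_at_clique_vertex[OF assms])
  then have "k \<in> N s" "k \<in> N t" by blast+
  then show ?thesis
    unfolding fibre_eq[OF st(1-3) \<open>k \<in> N s\<close> \<open>k \<in> N t\<close>] using st(3) by simp
qed

lemma nbhd_clique_vertex:
  assumes "k \<in> K"
  shows "nbhd G k \<inter> S = {s \<in> U. k \<in> N s}"
  using assms arc_commute by (auto simp: nbhd_def U_def)

text \<open>Injectivity holds because the two neighbours of \<open>k\<close> in \<open>U\<close>
  have no other common neighbour in \<open>K\<close>. Conversely an edge is the fibre of any common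
  neighbour of its ends.\<close>

lemma bij_betw_clique_edges:
  "bij_betw (\<lambda>k. {s \<in> U. k \<in> N s}) K (uedges (branch_graph G K))"
  unfolding bij_betw_def
proof
  show "inj_on (\<lambda>k. {s \<in> U. k \<in> N s}) K"
  proof (rule inj_onI)
    fix k l assume kl: "k \<in> K" "l \<in> K" "{s \<in> U. k \<in> N s} = {s \<in> U. l \<in> N s}"
    obtain s t where st: "s \<in> U" "t \<in> U" "s \<noteq> t" "N s \<inter> N t = {k}"
      by (rule ex_edge_at_clique_vertex[OF kl(1)])
    then have "s \<in> {s \<in> U. l \<in> N s}" "t \<in> {s \<in> U. l \<in> N s}"
      using kl(3) by blast+
    then have "l \<in> N s \<inter> N t" by blast
    then show "k = l" using st(4) by (metis singletonD)
  qed
  show "(\<lambda>k. {s \<in> U. k \<in> N s}) ` K = uedges (branch_graph G K)"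
  proof (intro equalityI subsetI)
    fix e assume "e \<in> (\<lambda>k. {s \<in> U. k \<in> N s}) ` K"
    then obtain k where k: "k \<in> K" "e = {s \<in> U. k \<in> N s}" by blast
    obtain s t where st: "s \<in> U" "t \<in> U" "s \<noteq> t" "N s \<inter> N t = {k}"
      by (rule ex_edge_at_clique_vertex[OF k(1)])
    then have "e = {s, t}" using k(2) fibre_eq[of s t k] by blast
    moreover have "(s, t) \<in> parcs (branch_graph G K)"
      using st by (auto simp: mem_edge_iff)
    ultimately show "e \<in> uedges (branch_graph G K)"
      by (auto simp: uedges_def)
  next
    fix e assume "e \<in> uedges (branch_graph G K)"
    then obtain s t where e: "e = {s, t}" "(s, t) \<in> parcs (branch_graph G K)"
      by (auto simp: uedges_def)
    then obtain k where "s \<in> U" "t \<in> U" "s \<noteq> t" "k \<in> N s" "k \<in> N t"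
      by (auto simp: mem_edge_iff)
    then show "e \<in> (\<lambda>k. {s \<in> U. k \<in> N s}) ` K"
      using fibre_eq[of s t k] e(1) by (intro image_eqI[of _ _ k]) auto
  qed
qed

text \<open>Vertices of the branch graph are handled by deleting them from \<open>S\<close>, edges
  by deleting a common neighbour of the ends from \<open>K\<close>.\<close>

lemma critical_branch_graph: "critical (h + 1) (branch_graph G K)"
proof -
  let ?B = "branch_graph G K"
  have "U \<noteq> {}"
    using not_colorable[of "\<lambda>_. 0"] h by auto
  then obtain v where v: "v \<in> U" by blast
  then have "v \<in> S" by (simp add: U_def)
  then obtain c :: "'a \<Rightarrow> nat" where c: "\<And>s. c s < h"
    "\<And>s t. s \<in> S - {v} \<Longrightarrow> t \<in> S - {v} \<Longrightarrow> \<not> nested_or_disjoint (N s) (N t) \<Longrightarrow> c s \<noteq> c t"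
    by (rule coloring_delete_stable_vertex) blast
  have cne: "c s \<noteq> h" for s using c(1)[of s] by simp
  have "proper_coloring ?B (h + 1) (c(v := h))"
    unfolding proper_coloring_def pverts_branch_graph
  proof (intro conjI ballI)
    show "(c(v := h)) s < h + 1" for s
      using c(1)[of s] by auto
    show "case e of (s, t) \<Rightarrow> (c(v := h)) s \<noteq> (c(v := h)) t" if "e \<in> parcs ?B" for e
    proof (cases e)
      case (Pair s t)
      then have st: "s \<in> U" "t \<in> U" "\<not> nested_or_disjoint (N s) (N t)"
        using that parcs_branch_graph by auto
      then have "s \<noteq> t" "s \<in> S" "t \<in> S"
        by (auto simp: nested_or_disjoint_def U_def)
      then show ?thesis
        using Pair st(3) c(2)[of s t] cne[of s] cne[of t] by auto
    qed
  qed
  then have "chromatic_number ?B \<le> h + 1"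
    by (rule chromatic_number_le)
  moreover have "\<not> chromatic_number ?B \<le> h"
  proof
    assume "chromatic_number ?B \<le> h"
    then obtain d where "proper_coloring ?B h d"
      using proper_coloring_chromatic_number[OF pair_graph_branch_graph[OF pair_graph]]
        proper_coloring_mono by blast
    then have "\<forall>s\<in>U. d s < h"
      "\<And>s t. (s, t) \<in> parcs ?B \<Longrightarrow> d s \<noteq> d t"
      by (auto simp: proper_coloring_def pverts_branch_graph)
    then show False
      using not_colorable[of d] parcs_branch_graph by blast
  qed
  ultimately have chi: "chromatic_number ?B = h + 1" by simp
  have del_vertex: "chromatic_number (delete_vertex ?B w) < h + 1" if w: "w \<in> U" for w
  proof -
    have "w \<in> S" using w by (simp add: U_def)
    then obtain c :: "'a \<Rightarrow> nat" where c: "\<And>s. c s < h"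
      "\<And>s t. s \<in> S - {w} \<Longrightarrow> t \<in> S - {w} \<Longrightarrow> \<not> nested_or_disjoint (N s) (N t) \<Longrightarrow> c s \<noteq> c t"
      by (rule coloring_delete_stable_vertex) blast
    have "proper_coloring (delete_vertex ?B w) h c"
      using c by (auto simp: proper_coloring_def delete_vertex_def parcs_branch_graph U_def)
    then show ?thesis
      using chromatic_number_le by fastforce
  qed
  have del_edge: "chromatic_number (delete_edge ?B s t) < h + 1" if e: "(s, t) \<in> parcs ?B" for s t
  proof -
    from e obtain k where k: "s \<in> U" "t \<in> U" "s \<noteq> t" "k \<in> N s" "k \<in> N t"
      by (auto simp: mem_edge_iff)
    then have "k \<in> K" by blast
    then obtain c :: "'a \<Rightarrow> nat" where c: "\<And>s. c s < h"
      "\<And>s t. s \<in> U \<Longrightarrow> t \<in> U \<Longrightarrow> s \<noteq> t \<Longrightarrow> N s \<inter> N t - {k} \<noteq> {} \<Longrightarrow> c s \<noteq> c t"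
      using coloring_delete_clique_vertex by blast
    \<comment> \<open>The fibre of \<open>k\<close> is just \<open>s\<close> and \<open>t\<close>,
      so the ends of any other edge share a neighbour different from \<open>k\<close> and are
      coloured differently by \<open>c\<close>.\<close>
    have "c u \<noteq> c v" if uv: "(u, v) \<in> parcs ?B" "(u, v) \<noteq> (s, t)" "(u, v) \<noteq> (t, s)" for u v
    proof -
      have U: "u \<in> U" "v \<in> U" "u \<noteq> v" "N u \<inter> N v \<noteq> {}"
        using uv(1) by (auto simp: mem_edge_iff)
      have "N u \<inter> N v \<noteq> {k}"
      proof
        assume "N u \<inter> N v = {k}"
        then have "k \<in> N u" "k \<in> N v" by blast+
        then have "{u, v} = {s, t}"
          by (simp only: fibre_eq[OF k, symmetric] fibre_eq[OF U(1-3), symmetric])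
        then show False
          using uv(2,3) by (auto simp: doubleton_eq_iff)
      qed
      then have "N u \<inter> N v - {k} \<noteq> {}"
        using U(4) by blast
      then show ?thesis
        using c(2) U by blast
    qed
    then have "proper_coloring (delete_edge ?B s t) h c"
      using c(1) by (auto simp: proper_coloring_def delete_edge_def)
    then show ?thesis
      using chromatic_number_le by fastforce
  qed
  show ?thesis
    unfolding critical_def pverts_branch_graph using chi del_vertex del_edge by auto
qed

end

theorem theorem16:
  fixes G :: "'a pair_pre_digraph" and S K :: "'a set" and h :: nat
  assumes "pair_graph G"
    and "Digraph_Component.connected (with_proj G)"
    and "VPT G"
    and "3 \<le> h"
    and "minimal_non_h21 h G"
    and "split_partition G S K"
  shows "(\<forall>k\<in>K. card (nbhd G k \<inter> S) = 2) \<and>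
    card (uedges (branch_graph G K)) = card K \<and>
    critical (h + 1) (branch_graph G K)"
proof -
  interpret minimal_non_h21_split G S K h
    using assms by unfold_locales
  show ?thesis
    using card_fibre nbhd_clique_vertex bij_betw_same_card[OF bij_betw_clique_edges]
      critical_branch_graph
    by simp
qed

end
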